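(* Suppose that there exists $(y^*,w^*,z^*,x^* )\in\mathbb{R}^m\times\mathcal{W}\times\mathbb{R}^n\times\mathbb{R}^n$ satisfying the KKT system $$Qw^*-Qx^*=0,\quad Ax^*\in\partial\delta_{\mathcal{K}}^*(-y^* ),\quad x^*\in\partial\phi^*(-z^* ),\quad -Qw^*+A^*y^*+z^*-c=0 .$$ Let $\sigma>0$, let $\lambda_Q>0$ satisfy $\lambda_Q\ge\lambda_1(Q)$, let $\mathcal{S}_w=Q(\lambda_Q I_n-Q)$, and let $\mathcal{S}_y$ be a self-adjoint positive semidefinite linear operator on $\mathbb{R}^m$ such that $\mathcal{S}_y+AA^*$ is positive definite. Let $\{(\bar y^k,\bar w^k,\bar z^k,\bar x^k)\}_{k\ge1}$ be generated by Algorithm A (defined in the context) and let $\{(\bar y^k,\bar w_Q^k,\bar z^k,\bar x^k)\}_{k\ge1}$ be generated by Algorithm B (defined in the context), both with these same $\sigma,\lambda_Q,\mathcal{S}_w,\mathcal{S}_y$ and both started from the same initial point in $\mathbb{R}^m\times\mathcal{W}\times\mathbb{R}^n\times\mathbb{R}^n$. Then the sequence $\{(\bar y^k,Q\bar w_Q^k,\bar z^k,\bar x^k)\}_{k\ge1}$ generated by Algorithm B coincides with the sequence $\{(\bar y^k,Q\bar w^k,\bar z^k,\bar x^k)\}_{k\ge1}$ generated by Algorithm A. Moreover, both sequences converge to a point $(y^*,Qw^*,z^*,x^* )$, where $(y^*,w^*,z^* )$ solves the dual problem (D) and $x^*$ solves the primal problem (P).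
   Context: Problem data: $Q:\mathbb{R}^n\to\mathbb{R}^n$ is a self-adjoint positive semidefinite linear operator, $\mathcal{W}:=\operatorname{Range}(Q)$, $c\in\mathbb{R}^n$, $\phi:\mathbb{R}^n\to(-\infty,+\infty]$ is proper, closed and convex, $A:\mathbb{R}^n\to\mathbb{R}^m$ is linear with adjoint $A^*$, and $\mathcal{K}=\{y\in\mathbb{R}^m\mid -\infty\le l_i\le y_i\le u_i\le+\infty,\ 1\le i\le m\}$. $\delta_{\mathcal{K}}$ is the indicator function of $\mathcal{K}$, $f^*$ denotes the convex conjugate of $f$, $\partial f$ the subdifferential, $\lambda_1(\cdot)$ the largest eigenvalue of a self-adjoint operator, $I_n$ the identity, and $\|x\|_{\mathcal{M}}=\sqrt{\langle x,\mathcal{M}x\rangle}$ for a self-adjoint positive semidefinite $\mathcal{M}$. Primal problem (P): $\min_{x\in\mathbb{R}^n}\{\tfrac12\langle x,Qx\rangle+\langle c,x\rangle+\phi(x)\mid Ax\in\mathcal{K}\}$. Restricted Wolfe dual problem (D): $\min_{(y,w,z)\in\mathbb{R}^m\times\mathbb{R}^n\times\mathbb{R}^n}\{\tfrac12\langle w,Qw\rangle+\delta_{\mathcal{K}}^*(-y)+\phi^*(-z)\mid -Qw+A^*y+z=c,\ w\in\mathcal{W}\}$. Augmented Lagrangian: for $\sigma>0$, $$L_\sigma(y,w,z;x)=\tfrac12\langle w,Qw\rangle+\delta_{\mathcal{K}}^*(-y)+\phi^*(-z)+\langle x,-Qw+A^*y+z-c\rangle+\tfrac{\sigma}{2}\|-Qw+A^*y+z-c\|^2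 .$$ (The same formula is used for $w\in\mathcal{W}$ and for $w\in\mathbb{R}^n$.) Algorithm A. Write $u=(y,w,z,x)$, $\bar u=(\bar y,\bar w,\bar z,\bar x)$. Given $u^0\in\mathbb{R}^m\times\mathcal{W}\times\mathbb{R}^n\times\mathbb{R}^n$, for $k=0,1,2,\dots$: 1. $\bar z^{k+1}=\arg\min_{z\in\mathbb{R}^n}L_\sigma(y^k,w^k,z;x^k)$; 2. $\bar x^{k+1}=x^k+\sigma(-Qw^k+A^*y^k+\bar z^{k+1}-c)$; 3. $\bar w^{k+1/2}=\arg\min_{w\in\mathcal{W}}\{L_\sigma(y^k,w,\bar z^{k+1};\bar x^{k+1})+\tfrac{\sigma}{2}\|w-w^k\|_{\mathcal{S}_w}^2\}$; 4. $\bar y^{k+1}=\arg\min_{y\in\mathbb{R}^m}\{L_\sigma(y,\bar w^{k+1/2},\bar z^{k+1};\bar x^{k+1})+\tfrac{\sigma}{2}\|y-y^k\|_{\mathcal{S}_y}^2\}$; 5. $\bar w^{k+1}=\arg\min_{w\in\mathcal{W}}\{L_\sigma(\bar y^{k+1},w,\bar z^{k+1};\bar x^{k+1})+\tfrac{\sigma}{2}\|w-w^k\|_{\mathcal{S}_w}^2\}$; 6. $\hat u^{k+1}=2\bar u^{k+1}-u^k$; 7. $u^{k+1}=\tfrac{1}{k+2}u^0+\tfrac{k+1}{k+2}\hat u^{k+1}$. Algorithm B. Write $u_Q=(y,w_Q,z,x)$, $\bar u_Q=(\bar y,\bar w_Q,\bar z,\bar x)$. Given $u_Q^0\in\mathbb{R}^m\times\mathbb{R}^n\times\mathbb{R}^n\times\mathbb{R}^n$,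 for $k=0,1,2,\dots$: 1. $\bar z^{k+1}=\arg\min_{z\in\mathbb{R}^n}L_\sigma(y^k,w_Q^k,z;x^k)$; 2. $\bar x^{k+1}=x^k+\sigma(-Qw_Q^k+A^*y^k+\bar z^{k+1}-c)$; 3. $\bar w_Q^{k+1/2}=\frac{1}{1+\sigma\lambda_Q}\big(\sigma\lambda_Qw_Q^k+\bar x^{k+1}+\sigma(-Qw_Q^k+A^*y^k+\bar z^{k+1}-c)\big)$; 4. $\bar y^{k+1}=\arg\min_{y\in\mathbb{R}^m}\{L_\sigma(y,\bar w_Q^{k+1/2},\bar z^{k+1};\bar x^{k+1})+\tfrac{\sigma}{2}\|y-y^k\|_{\mathcal{S}_y}^2\}$; 5. $\bar w_Q^{k+1}=\frac{1}{1+\sigma\lambda_Q}\big(\sigma\lambda_Qw_Q^k+\bar x^{k+1}+\sigma(-Qw_Q^k+A^*\bar y^{k+1}+\bar z^{k+1}-c)\big)$; 6. $\hat u_Q^{k+1}=2\bar u_Q^{k+1}-u_Q^k$; 7. $u_Q^{k+1}=\tfrac{1}{k+2}u_Q^0+\tfrac{k+1}{k+2}\hat u_Q^{k+1}$.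
   Formalization: In the subproblems with y=y^k fixed (the z-step of both algorithms and the half-step for w in Algorithm A) the constant δ_K^*(-y^k) is dropped from L_σ, since it may be +∞ and then the argmin is undefined; when it is finite the minimisers are unchanged. *)

theory Defs
  imports "HOL-Analysis.Analysis"
begin

section \<open>Linear operators\<close>

definition self_adjoint :: "('a::euclidean_space \<Rightarrow> 'a) \<Rightarrow> bool" where
  "self_adjoint M \<longleftrightarrow> linear M \<and> adjoint M = M"

definition pos_semidef :: "('a::euclidean_space \<Rightarrow> 'a) \<Rightarrow> bool" where
  "pos_semidef M \<longleftrightarrow> (\<forall>x. 0 \<le> x \<bullet> M x)"

definition pos_def :: "('a::euclidean_space \<Rightarrow> 'a) \<Rightarrow> bool" where
  "pos_def M \<longleftrightarrow> (\<forall>x. x \<noteq> 0 \<longrightarrow> 0 < x \<bullet> M x)"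

text \<open>For self-adjoint \<open>M\<close> this set of eigenvalues is finite and nonempty, so that \<open>Max\<close> is meaningful.\<close>

definition largest_eigenvalue :: "('a::euclidean_space \<Rightarrow> 'a) \<Rightarrow> real" where
  "largest_eigenvalue M = Max {l. \<exists>v. v \<noteq> 0 \<and> M v = l *\<^sub>R v}"

definition op_norm :: "('a::euclidean_space \<Rightarrow> 'a) \<Rightarrow> 'a \<Rightarrow> real" where
  "op_norm M x = sqrt (x \<bullet> M x)"

section \<open>Extended-real-valued convex functions\<close>

text \<open>The library's \<open>epigraph\<close> is for real-valued functions only.\<close>

definition epi :: "('a::euclidean_space \<Rightarrow> ereal) \<Rightarrow> ('a \<times> real) set" where
  "epi f = {(x, t). f x \<le> ereal t}"

definition proper_fun :: "('a::euclidean_space \<Rightarrow> ereal) \<Rightarrow> bool" where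
  "proper_fun f \<longleftrightarrow> (\<forall>x. f x \<noteq> -\<infinity>) \<and> (\<exists>x. f x \<noteq> \<infinity>)"

definition closed_fun :: "('a::euclidean_space \<Rightarrow> ereal) \<Rightarrow> bool" where
  "closed_fun f \<longleftrightarrow> closed (epi f)"

definition convex_fun :: "('a::euclidean_space \<Rightarrow> ereal) \<Rightarrow> bool" where
  "convex_fun f \<longleftrightarrow> convex (epi f)"

definition conjugate :: "('a::euclidean_space \<Rightarrow> ereal) \<Rightarrow> 'a \<Rightarrow> ereal" where
  "conjugate f y = (SUP x. ereal (y \<bullet> x) - f x)"

text \<open>The subdifferential is empty wherever the function is not finite.\<close>

definition subdiff :: "('a::euclidean_space \<Rightarrow> ereal) \<Rightarrow> 'a \<Rightarrow> 'a set" where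
  "subdiff f x = {s. \<bar>f x\<bar> \<noteq> \<infinity> \<and> (\<forall>z. f x + ereal (s \<bullet> (z - x)) \<le> f z)}"

definition ind_fun :: "'a set \<Rightarrow> 'a \<Rightarrow> ereal" where
  "ind_fun K y = (if y \<in> K then 0 else \<infinity>)"

definition box_set :: "('m \<Rightarrow> ereal) \<Rightarrow> ('m \<Rightarrow> ereal) \<Rightarrow> (real^'m) set" where
  "box_set l u = {y. \<forall>i. l i \<le> ereal (y $ i) \<and> ereal (y $ i) \<le> u i}"

section \<open>The primal and dual problems\<close>

definition KKT_point ::
  "(real^'n \<Rightarrow> real^'n) \<Rightarrow> (real^'n \<Rightarrow> real^'m) \<Rightarrow> real^'n \<Rightarrow> (real^'n \<Rightarrow> ereal) \<Rightarrow> (real^'m) set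
    \<Rightarrow> real^'m \<Rightarrow> real^'n \<Rightarrow> real^'n \<Rightarrow> real^'n \<Rightarrow> bool" where
  "KKT_point Q A c \<phi> K y w z x \<longleftrightarrow>
     w \<in> range Q \<and>
     Q w - Q x = 0 \<and>
     A x \<in> subdiff (conjugate (ind_fun K)) (- y) \<and>
     x \<in> subdiff (conjugate \<phi>) (- z) \<and>
     - Q w + adjoint A y + z - c = 0"

definition solves_primal ::
  "(real^'n \<Rightarrow> real^'n) \<Rightarrow> (real^'n \<Rightarrow> real^'m) \<Rightarrow> real^'n \<Rightarrow> (real^'n \<Rightarrow> ereal) \<Rightarrow> (real^'m) set
    \<Rightarrow> real^'n \<Rightarrow> bool" where
  "solves_primal Q A c \<phi> K =
     is_arg_min (\<lambda>x. ereal (1/2 * (x \<bullet> Q x) + c \<bullet> x) + \<phi> x) (\<lambda>x. A x \<in> K)"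

definition solves_dual ::
  "(real^'n \<Rightarrow> real^'n) \<Rightarrow> (real^'n \<Rightarrow> real^'m) \<Rightarrow> real^'n \<Rightarrow> (real^'n \<Rightarrow> ereal) \<Rightarrow> (real^'m) set
    \<Rightarrow> (real^'m) \<times> (real^'n) \<times> (real^'n) \<Rightarrow> bool" where
  "solves_dual Q A c \<phi> K =
     is_arg_min
       (\<lambda>(y, w, z). ereal (1/2 * (w \<bullet> Q w)) + conjugate (ind_fun K) (- y) + conjugate \<phi> (- z))
       (\<lambda>(y, w, z). - Q w + adjoint A y + z = c \<and> w \<in> range Q)"

section \<open>The augmented Lagrangian\<close>

text \<open>
  The functions \<open>p\<close> and \<open>q\<close> stand for the conjugates of the indicator of \<open>K\<close> and of \<open>\<phi>\<close>; they
  are parameters because some subproblems below are posed with \<open>p = 0\<close>.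
\<close>

definition aug_lag ::
  "(real^'n \<Rightarrow> real^'n) \<Rightarrow> (real^'n \<Rightarrow> real^'m) \<Rightarrow> real^'n \<Rightarrow> (real^'m \<Rightarrow> ereal) \<Rightarrow> (real^'n \<Rightarrow> ereal)
    \<Rightarrow> real \<Rightarrow> real^'m \<Rightarrow> real^'n \<Rightarrow> real^'n \<Rightarrow> real^'n \<Rightarrow> ereal" where
  "aug_lag Q A c p q \<sigma> y w z x =
     ereal (1/2 * (w \<bullet> Q w)) + p (- y) + q (- z)
     + ereal (x \<bullet> (- Q w + adjoint A y + z - c))
     + ereal (\<sigma>/2 * (norm (- Q w + adjoint A y + z - c))\<^sup>2)"

text \<open>
  When \<open>y\<close> is held fixed, \<open>p (- y)\<close> is constant in the minimisation variable and leaving it out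
  does not change the minimisers, provided it is finite.  The iterate \<open>y\<^sup>k\<close> of the algorithms,
  being the initial point or an extrapolation, need not lie in the domain of \<open>y \<mapsto> p (- y)\<close>.
  The augmented Lagrangian is then constantly \<open>\<infinity>\<close> and every point would be a minimiser, so the
  subproblems in which \<open>y = y\<^sup>k\<close> is fixed are posed with \<open>p = 0\<close>, as usual.
\<close>

lemma aug_lag_drop_const:
  assumes "\<bar>p (- y)\<bar> \<noteq> \<infinity>"
  shows "aug_lag Q A c p q \<sigma> y w z x = aug_lag Q A c (\<lambda>_. 0) q \<sigma> y w z x + p (- y)"
  unfolding aug_lag_def by (simp add: ac_simps)

lemma is_arg_min_add_const:
  fixes F :: "'a \<Rightarrow> ereal"
  assumes "\<bar>a\<bar> \<noteq> \<infinity>"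
  shows "is_arg_min (\<lambda>v. F v + a) P = is_arg_min F P"
proof -
  have "F v + a < F u + a \<longleftrightarrow> F v < F u" for u v
  proof -
    obtain r where "a = ereal r" using assms by (cases a) auto
    then show ?thesis by (cases "F u"; cases "F v") auto
  qed
  then show ?thesis by (simp add: is_arg_min_def fun_eq_iff)
qed

lemma arg_min_z_drop_const:
  assumes "\<bar>p (- y)\<bar> \<noteq> \<infinity>"
  shows "is_arg_min (\<lambda>z. aug_lag Q A c p q \<sigma> y w z x) P
       = is_arg_min (\<lambda>z. aug_lag Q A c (\<lambda>_. 0) q \<sigma> y w z x) P"
  unfolding aug_lag_drop_const[where p = p, OF assms] by (rule is_arg_min_add_const[OF assms])

lemma arg_min_w_drop_const:
  assumes "\<bar>p (- y)\<bar> \<noteq> \<infinity>"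
  shows "is_arg_min (\<lambda>w. aug_lag Q A c p q \<sigma> y w z x + ereal (g w)) P
       = is_arg_min (\<lambda>w. aug_lag Q A c (\<lambda>_. 0) q \<sigma> y w z x + ereal (g w)) P"
proof -
  have "aug_lag Q A c p q \<sigma> y w z x + ereal (g w)
      = (aug_lag Q A c (\<lambda>_. 0) q \<sigma> y w z x + ereal (g w)) + p (- y)" for w
    unfolding aug_lag_drop_const[where p = p, OF assms] by (simp add: ac_simps)
  then show ?thesis by (simp only: is_arg_min_add_const[OF assms])
qed

section \<open>The algorithms\<close>

type_synonym ('m, 'n) state = "(real^'m) \<times> (real^'n) \<times> (real^'n) \<times> (real^'n)"

text \<open>
  States are ordered \<open>(y, w, z, x)\<close>.  A step relates \<open>u\<^sup>k\<close> to the next barred iterate, whose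
  components and the intermediate \<open>w\<close> carry the suffixes \<open>b\<close> and \<open>h\<close>.
\<close>

definition step_A ::
  "(real^'n \<Rightarrow> real^'n) \<Rightarrow> (real^'n \<Rightarrow> real^'m) \<Rightarrow> real^'n \<Rightarrow> (real^'n \<Rightarrow> ereal) \<Rightarrow> (real^'m) set
    \<Rightarrow> real \<Rightarrow> (real^'n \<Rightarrow> real^'n) \<Rightarrow> (real^'m \<Rightarrow> real^'m)
    \<Rightarrow> ('m, 'n) state \<Rightarrow> ('m, 'n) state \<Rightarrow> bool" where
  "step_A Q A c \<phi> K \<sigma> Sw Sy u ub \<longleftrightarrow>
     (\<exists>y w z x yb wb zb xb wh.
        u = (y, w, z, x) \<and> ub = (yb, wb, zb, xb) \<and>
        is_arg_min (\<lambda>z'. aug_lag Q A c (\<lambda>_. 0) (conjugate \<phi>) \<sigma> y w z' x) (\<lambda>_. True) zb \<and>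
        xb = x + \<sigma> *\<^sub>R (- Q w + adjoint A y + zb - c) \<and>
        is_arg_min
          (\<lambda>w'. aug_lag Q A c (\<lambda>_. 0) (conjugate \<phi>) \<sigma> y w' zb xb
                + ereal (\<sigma>/2 * (op_norm Sw (w' - w))\<^sup>2))
          (\<lambda>w'. w' \<in> range Q) wh \<and>
        is_arg_min
          (\<lambda>y'. aug_lag Q A c (conjugate (ind_fun K)) (conjugate \<phi>) \<sigma> y' wh zb xb
                + ereal (\<sigma>/2 * (op_norm Sy (y' - y))\<^sup>2))
          (\<lambda>_. True) yb \<and>
        is_arg_min
          (\<lambda>w'. aug_lag Q A c (conjugate (ind_fun K)) (conjugate \<phi>) \<sigma> yb w' zb xb
                + ereal (\<sigma>/2 * (op_norm Sw (w' - w))\<^sup>2))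
          (\<lambda>w'. w' \<in> range Q) wb)"

definition step_B ::
  "(real^'n \<Rightarrow> real^'n) \<Rightarrow> (real^'n \<Rightarrow> real^'m) \<Rightarrow> real^'n \<Rightarrow> (real^'n \<Rightarrow> ereal) \<Rightarrow> (real^'m) set
    \<Rightarrow> real \<Rightarrow> real \<Rightarrow> (real^'m \<Rightarrow> real^'m)
    \<Rightarrow> ('m, 'n) state \<Rightarrow> ('m, 'n) state \<Rightarrow> bool" where
  "step_B Q A c \<phi> K \<sigma> lamQ Sy u ub \<longleftrightarrow>
     (\<exists>y w z x yb wb zb xb wh.
        u = (y, w, z, x) \<and> ub = (yb, wb, zb, xb) \<and>
        is_arg_min (\<lambda>z'. aug_lag Q A c (\<lambda>_. 0) (conjugate \<phi>) \<sigma> y w z' x) (\<lambda>_. True) zb \<and>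
        xb = x + \<sigma> *\<^sub>R (- Q w + adjoint A y + zb - c) \<and>
        wh = (1 / (1 + \<sigma> * lamQ)) *\<^sub>R
               ((\<sigma> * lamQ) *\<^sub>R w + xb + \<sigma> *\<^sub>R (- Q w + adjoint A y + zb - c)) \<and>
        is_arg_min
          (\<lambda>y'. aug_lag Q A c (conjugate (ind_fun K)) (conjugate \<phi>) \<sigma> y' wh zb xb
                + ereal (\<sigma>/2 * (op_norm Sy (y' - y))\<^sup>2))
          (\<lambda>_. True) yb \<and>
        wb = (1 / (1 + \<sigma> * lamQ)) *\<^sub>R
               ((\<sigma> * lamQ) *\<^sub>R w + xb + \<sigma> *\<^sub>R (- Q w + adjoint A yb + zb - c)))"

definition halpern_update ::
  "nat \<Rightarrow> 'a::real_vector \<Rightarrow> 'a \<Rightarrow> 'a \<Rightarrow> 'a" where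
  "halpern_update k u0 u ub =
     (1 / (real k + 2)) *\<^sub>R u0 + ((real k + 1) / (real k + 2)) *\<^sub>R (2 *\<^sub>R ub - u)"

text \<open>The value of \<open>ub\<close> at \<open>0\<close> is irrelevant: the barred iterates start at index 1.\<close>

definition generated_A ::
  "(real^'n \<Rightarrow> real^'n) \<Rightarrow> (real^'n \<Rightarrow> real^'m) \<Rightarrow> real^'n \<Rightarrow> (real^'n \<Rightarrow> ereal) \<Rightarrow> (real^'m) set
    \<Rightarrow> real \<Rightarrow> (real^'n \<Rightarrow> real^'n) \<Rightarrow> (real^'m \<Rightarrow> real^'m)
    \<Rightarrow> ('m, 'n) state \<Rightarrow> (nat \<Rightarrow> ('m, 'n) state) \<Rightarrow> (nat \<Rightarrow> ('m, 'n) state) \<Rightarrow> bool" where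
  "generated_A Q A c \<phi> K \<sigma> Sw Sy u0 u ub \<longleftrightarrow>
     u 0 = u0 \<and>
     (\<forall>k. step_A Q A c \<phi> K \<sigma> Sw Sy (u k) (ub (Suc k)) \<and>
          u (Suc k) = halpern_update k u0 (u k) (ub (Suc k)))"

definition generated_B ::
  "(real^'n \<Rightarrow> real^'n) \<Rightarrow> (real^'n \<Rightarrow> real^'m) \<Rightarrow> real^'n \<Rightarrow> (real^'n \<Rightarrow> ereal) \<Rightarrow> (real^'m) set
    \<Rightarrow> real \<Rightarrow> real \<Rightarrow> (real^'m \<Rightarrow> real^'m)
    \<Rightarrow> ('m, 'n) state \<Rightarrow> (nat \<Rightarrow> ('m, 'n) state) \<Rightarrow> (nat \<Rightarrow> ('m, 'n) state) \<Rightarrow> bool" where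
  "generated_B Q A c \<phi> K \<sigma> lamQ Sy u0 u ub \<longleftrightarrow>
     u 0 = u0 \<and>
     (\<forall>k. step_B Q A c \<phi> K \<sigma> lamQ Sy (u k) (ub (Suc k)) \<and>
          u (Suc k) = halpern_update k u0 (u k) (ub (Suc k)))"

definition apply_Q :: "(real^'n \<Rightarrow> real^'n) \<Rightarrow> ('m, 'n) state \<Rightarrow> ('m, 'n) state" where
  "apply_Q Q = (\<lambda>(y, w, z, x). (y, Q w, z, x))"

end

theory Submission
  imports Defs "HOL-Real_Asymp.Real_Asymp"
begin

text \<open>
  Both algorithms are Halpern iterations of a degenerate proximal point method.  Write
  \<open>u = (y, w, z, x)\<close> and let \<open>T\<close> be the monotone operator whose zeros are the KKT points.  The
  optimality conditions of one sweep express \<open>Q w\<close> at the intermediate point \<open>w\<^sup>k\<^sup>+\<^sup>1\<^sup>/\<^sup>2\<close> by the other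
  components; eliminating it turns the sweep into the inclusion \<open>M (u - ub) \<in> T ub\<close> for a
  self-adjoint positive semidefinite \<open>M\<close> (\<open>prec\<close>, \<open>opt_step_kkt_op\<close>).

  The algorithms agree because a sweep sees \<open>w\<close> only through \<open>Q w\<close>.  Minimising over \<open>range Q\<close>
  in Algorithm A makes a gradient vanish that lies in \<open>range Q\<close>; with the chosen \<open>Sw\<close> this
  equation is the image under \<open>Q\<close> of the explicit formula of Algorithm B.  So both algorithms satisfy
  the same conditions \<open>opt_step\<close>, and monotonicity makes these determine \<open>(y, Q w, z, x)\<close>
  uniquely (\<open>opt_step_unique\<close>).

  For convergence, monotonicity of \<open>T\<close> makes \<open>u \<mapsto> 2 ub - u\<close> nonexpansive in the seminorm of \<open>M\<close>.
  The classical argument for Halpern iterations then gives, in this seminorm, bounded iterates,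
  vanishing residuals \<open>u - ub\<close>, and convergence to a zero \<open>p\<close> of \<open>T\<close>, provided that the inner products of
  \<open>u\<^sup>0 - p\<close> with \<open>u\<^sup>k - p\<close> have limit superior at most \<open>0\<close>.  For \<open>p\<close> the projection of \<open>u\<^sup>0\<close> onto
  the zeros this holds: cluster points of the resolvent values are zeros of \<open>T\<close>, the graph of \<open>T\<close> being closed.

  The seminorm is degenerate, so convergence in it says nothing about single components.  The
  missing ingredient is \<open>kkt_error_bound\<close>: for a point that is a resolvent value, the
  distance to a zero in \<open>(y, Q w, z, x)\<close> is controlled by \<open>M\<close> and the residual alone.  It yields the
  compactness needed for the projection and the cluster points, and finally turns
  convergence in the seminorm into convergence of the iterates.
\<close>

section \<open>Positive semidefinite operators\<close>

text \<open>
  The form in which first-order conditions are read off from one-sided comparisons along a segment: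
  for small \<open>t\<close> the quadratic term is negligible.
\<close>

lemma first_order_nonneg:
  fixes a b :: real
  assumes "\<And>t. 0 < t \<Longrightarrow> t \<le> 1 \<Longrightarrow> 0 \<le> t * a + t\<^sup>2 * b"
  shows "0 \<le> a"
proof (rule ccontr)
  assume "\<not> 0 \<le> a"
  \<comment> \<open>Small enough that the quadratic term is at most half of the linear one.\<close>
  define t where "t = min 1 (- a / (2 * (\<bar>b\<bar> + 1)))"
  have t: "0 < t" "t \<le> 1" using \<open>\<not> 0 \<le> a\<close> by (auto simp: t_def divide_neg_pos)
  have "t * b \<le> t * (\<bar>b\<bar> + 1)" using t by (intro mult_left_mono) auto
  also have "\<dots> \<le> (- a / (2 * (\<bar>b\<bar> + 1))) * (\<bar>b\<bar> + 1)"
    by (intro mult_right_mono) (auto simp: t_def)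
  also have "\<dots> = - a / 2" by (simp add: field_simps)
  finally have "a + t * b < 0" using \<open>\<not> 0 \<le> a\<close> by simp
  then have "t * (a + t * b) < 0" using t by (simp add: mult_pos_neg)
  with assms[OF t] show False by (simp add: algebra_simps power2_eq_square)
qed

lemma self_adjoint_linear: "self_adjoint M \<Longrightarrow> linear M"
  by (simp add: self_adjoint_def)

lemma self_adjoint_swap: "self_adjoint M \<Longrightarrow> M a \<bullet> b = a \<bullet> M b"
  using adjoint_works[of M a b] by (simp add: self_adjoint_def)

lemma self_adjointI:
  assumes "linear M" "\<And>a b. M a \<bullet> b = a \<bullet> M b" shows "self_adjoint M"
  using assms adjoint_unique[of M M] by (simp add: self_adjoint_def)

lemma form_sum:
  assumes "self_adjoint M"
  shows "(a + b) \<bullet> M (a + b) = a \<bullet> M a + 2 * (a \<bullet> M b) + b \<bullet> M b"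
  using self_adjoint_swap[OF assms, of a b]
  by (simp add: linear_add[OF self_adjoint_linear[OF assms]] inner_simps inner_commute)

lemma form_sum_scaled:
  assumes "self_adjoint M"
  shows "(a + t *\<^sub>R b) \<bullet> M (a + t *\<^sub>R b) = a \<bullet> M a + t * (2 * (a \<bullet> M b)) + t\<^sup>2 * (b \<bullet> M b)"
  using form_sum[OF assms, of a "t *\<^sub>R b"]
  by (simp add: linear_cmul[OF self_adjoint_linear[OF assms]] power2_eq_square algebra_simps)

lemma psd_cauchy_schwarz:
  assumes "self_adjoint M" "pos_semidef M"
  shows "(a \<bullet> M b)\<^sup>2 \<le> (a \<bullet> M a) * (b \<bullet> M b)"
proof -
  have nn: "0 \<le> a \<bullet> M a + t * (2 * (a \<bullet> M b)) + t\<^sup>2 * (b \<bullet> M b)" for t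
    using assms(2) form_sum_scaled[OF assms(1), of a t b] by (metis pos_semidef_def)
  show ?thesis
  proof (cases "b \<bullet> M b = 0")
    case True
    have "a \<bullet> M b = 0"
    proof (rule ccontr)
      assume "a \<bullet> M b \<noteq> 0"
      with nn[of "- (a \<bullet> M a + 1) / (2 * (a \<bullet> M b))"] True show False by simp
    qed
    with True show ?thesis by simp
  next
    case False
    then have pos: "b \<bullet> M b > 0" using assms(2) by (simp add: pos_semidef_def less_le)
    have "0 \<le> (b \<bullet> M b) * (a \<bullet> M a + (- (a \<bullet> M b) / (b \<bullet> M b)) * (2 * (a \<bullet> M b))
       + (- (a \<bullet> M b) / (b \<bullet> M b))\<^sup>2 * (b \<bullet> M b))"
      using nn pos by (metis mult_nonneg_nonneg less_imp_le)
    also have "\<dots> = (a \<bullet> M a) * (b \<bullet> M b) - (a \<bullet> M b)\<^sup>2"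
      using pos by (simp add: field_simps power2_eq_square)
    finally show ?thesis by simp
  qed
qed

lemma op_norm_sq: "pos_semidef M \<Longrightarrow> (op_norm M a)\<^sup>2 = a \<bullet> M a"
  by (simp add: op_norm_def pos_semidef_def)

lemma op_norm_nonneg: "pos_semidef M \<Longrightarrow> 0 \<le> op_norm M a"
  by (simp add: op_norm_def pos_semidef_def)

lemma form_le_op_norm:
  assumes "self_adjoint M" "pos_semidef M"
  shows "\<bar>a \<bullet> M b\<bar> \<le> op_norm M a * op_norm M b"
  using real_sqrt_le_mono[OF psd_cauchy_schwarz[OF assms, of a b]]
  by (simp add: op_norm_def real_sqrt_mult)

lemma op_norm_triangle:
  assumes "self_adjoint M" "pos_semidef M"
  shows "op_norm M (a + b) \<le> op_norm M a + op_norm M b"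
proof (rule power2_le_imp_le)
  show "(op_norm M (a + b))\<^sup>2 \<le> (op_norm M a + op_norm M b)\<^sup>2"
    using form_le_op_norm[OF assms, of a b] form_sum[OF assms(1), of a b]
    by (simp add: power2_sum op_norm_sq[OF assms(2)])
qed (simp add: op_norm_nonneg[OF assms(2)])

lemma op_norm_scaleR:
  assumes "linear M" shows "op_norm M (t *\<^sub>R a) = \<bar>t\<bar> * op_norm M a"
proof -
  have "(t *\<^sub>R a) \<bullet> M (t *\<^sub>R a) = t\<^sup>2 * (a \<bullet> M a)"
    by (simp add: linear_cmul[OF assms] power2_eq_square)
  then show ?thesis by (simp add: op_norm_def real_sqrt_mult)
qed

text \<open>
  A degenerate seminorm still controls \<open>M a\<close>: apply Cauchy--Schwarz to \<open>M a\<close> and \<open>a\<close>.  This is how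
  estimates in the seminorm become estimates in the norm.
\<close>

lemma norm_le_op_norm:
  assumes "self_adjoint M" "pos_semidef M"
  obtains C where "C > 0" "\<And>a. norm (M a) \<le> C * op_norm M a"
proof -
  obtain B where B: "B > 0" "\<And>a. norm (M a) \<le> B * norm a"
    using linear_bounded_pos[OF self_adjoint_linear[OF assms(1)]] by blast
  have upper: "op_norm M a \<le> sqrt B * norm a" for a
  proof -
    have "a \<bullet> M a \<le> norm a * (B * norm a)"
      by (meson B(2) norm_cauchy_schwarz order_trans mult_left_mono norm_ge_zero)
    then have "sqrt (a \<bullet> M a) \<le> sqrt (B * (norm a)\<^sup>2)"
      by (simp add: power2_eq_square algebra_simps)
    then show ?thesis by (simp add: op_norm_def real_sqrt_mult)
  qed
  have "norm (M a) \<le> sqrt B * op_norm M a" for a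
  proof (cases "M a = 0")
    case True
    then show ?thesis using B(1) op_norm_nonneg[OF assms(2)] by simp
  next
    case False
    have "norm (M a) * norm (M a) = M a \<bullet> M a" by (simp add: power2_norm_eq_inner[symmetric] power2_eq_square)
    also have "\<dots> \<le> op_norm M (M a) * op_norm M a" using form_le_op_norm[OF assms, of "M a" a] by linarith
    also have "\<dots> \<le> (sqrt B * norm (M a)) * op_norm M a"
      by (intro mult_right_mono upper op_norm_nonneg assms)
    finally have "norm (M a) * norm (M a) \<le> norm (M a) * (sqrt B * op_norm M a)" by (simp add: ac_simps)
    then show ?thesis using False by simp
  qed
  with B(1) that[of "sqrt B"] show thesis by simp
qed

text \<open>
  Eigenvectors to different eigenvalues are orthogonal, so there are finitely many eigenvalues and the
  maximum in the definition of the largest one is attained.  A maximiser \<open>v\<close> of the Rayleigh quotient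
  with value \<open>m\<close> makes the positive semidefinite form of \<open>m I - M\<close> vanish at \<open>v\<close>; by
  Cauchy--Schwarz \<open>v\<close> is then in the kernel of \<open>m I - M\<close>, so that \<open>m\<close> is itself an eigenvalue.
\<close>

lemma rayleigh_le_largest_eigenvalue:
  fixes M :: "'a::euclidean_space \<Rightarrow> 'a"
  assumes "self_adjoint M"
  shows "w \<bullet> M w \<le> largest_eigenvalue M * (w \<bullet> w)"
proof -
  let ?E = "{l. \<exists>v. v \<noteq> 0 \<and> M v = l *\<^sub>R v}"
  note lin = self_adjoint_linear[OF assms]
  have "finite ?E"
  proof -
    obtain V where V: "\<And>l. l \<in> ?E \<Longrightarrow> V l \<noteq> 0 \<and> M (V l) = l *\<^sub>R V l"
      using bchoice[of ?E "\<lambda>l v. v \<noteq> 0 \<and> M v = l *\<^sub>R v"] by auto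
    have orth: "V k \<bullet> V l = 0" if "k \<in> ?E" "l \<in> ?E" "k \<noteq> l" for k l
    proof -
      have "k * (V k \<bullet> V l) = l * (V k \<bullet> V l)"
        using self_adjoint_swap[OF assms, of "V k" "V l"] V[OF that(1)] V[OF that(2)] by simp
      with that(3) show ?thesis by simp
    qed
    have inj: "inj_on V ?E"
      using orth V by (metis (no_types, lifting) inj_onI inner_eq_zero_iff)
    have "pairwise orthogonal (V ` ?E)"
      using orth by (auto simp: pairwise_def orthogonal_def)
    moreover have "0 \<notin> V ` ?E" using V by force
    ultimately have "independent (V ` ?E)" by (rule pairwise_orthogonal_independent)
    then have "finite (V ` ?E)" using independent_bound by blast
    then show ?thesis using inj finite_imageD by blast
  qed
  have "compact (sphere (0::'a) 1)" "sphere (0::'a) 1 \<noteq> {}" by auto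
  moreover have "continuous_on (sphere 0 1) (\<lambda>v. v \<bullet> M v)"
    by (intro continuous_intros linear_continuous_on linear_conv_bounded_linear[THEN iffD1] lin)
  ultimately obtain v where v: "v \<in> sphere 0 1" "\<And>a. a \<in> sphere 0 1 \<Longrightarrow> a \<bullet> M a \<le> v \<bullet> M v"
    using continuous_attains_sup by metis
  define m where "m = v \<bullet> M v"
  have vv: "v \<bullet> v = 1" using v(1) by (simp add: norm_eq_1)
  have m: "a \<bullet> M a \<le> m * (a \<bullet> a)" for a
  proof (cases "a = 0")
    case False
    have "(inverse (norm a) *\<^sub>R a) \<bullet> M (inverse (norm a) *\<^sub>R a) \<le> m"
      unfolding m_def using False by (intro v(2)) simp
    then have "(a \<bullet> M a) / (norm a)\<^sup>2 \<le> m"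
      by (simp add: linear_cmul[OF lin] power2_eq_square divide_inverse ac_simps)
    with False show ?thesis by (simp add: field_simps power2_norm_eq_inner)
  qed (simp add: linear_0[OF lin])
  let ?G = "\<lambda>a. m *\<^sub>R a - M a"
  have G: "self_adjoint ?G" "pos_semidef ?G"
    using self_adjoint_swap[OF assms] m
    by (auto intro!: self_adjointI linear_compose_sub lin linear_compose_scale_right linear_ident
        simp: inner_simps pos_semidef_def)
  have "?G v \<bullet> ?G v = 0"
    using psd_cauchy_schwarz[OF G, of "?G v" v] vv by (simp add: m_def inner_simps)
  then have "M v = m *\<^sub>R v" by simp
  moreover have "v \<noteq> 0" using vv by auto
  ultimately have "m \<in> ?E" by blast
  then have "m \<le> largest_eigenvalue M"
    unfolding largest_eigenvalue_def using \<open>finite ?E\<close> by (rule Max_ge[rotated])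
  with m[of w] show ?thesis by (meson inner_ge_zero mult_right_mono order_trans)
qed

text \<open>
  \<open>Q\<^sup>2 \<le> L Q\<close>, by Cauchy--Schwarz for the form of \<open>Q\<close> at \<open>Q w\<close> and \<open>w\<close>.  With \<open>L = lamQ\<close> this says
  that \<open>Q (lamQ I - Q)\<close> is positive semidefinite.
\<close>

lemma psd_square_le:
  assumes "self_adjoint Q" "pos_semidef Q" "\<And>w. w \<bullet> Q w \<le> L * (w \<bullet> w)"
  shows "Q w \<bullet> Q w \<le> L * (w \<bullet> Q w)"
proof (cases "Q w = 0")
  case True
  then show ?thesis by simp
next
  case False
  have "(Q w \<bullet> Q w)\<^sup>2 \<le> (Q w \<bullet> Q (Q w)) * (w \<bullet> Q w)"
    using psd_cauchy_schwarz[OF assms(1,2), of "Q w" w] .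
  also have "\<dots> \<le> (L * (Q w \<bullet> Q w)) * (w \<bullet> Q w)"
    using assms(2,3) by (intro mult_right_mono) (auto simp: pos_semidef_def)
  finally have "(Q w \<bullet> Q w) * (Q w \<bullet> Q w) \<le> (Q w \<bullet> Q w) * (L * (w \<bullet> Q w))"
    by (simp add: power2_eq_square ac_simps)
  then show ?thesis using False by simp
qed

section \<open>Subgradients and conjugates\<close>

lemma subdiff_iff:
  "s \<in> subdiff f x \<longleftrightarrow> (\<exists>r. f x = ereal r \<and> (\<forall>z. ereal (r + s \<bullet> (z - x)) \<le> f z))"
proof (cases "f x")
  case (real r)
  then show ?thesis unfolding subdiff_def mem_Collect_eq
    by (metis MInfty_neq_ereal(1) PInfty_neq_ereal(1) abs_ereal.simps(1) plus_ereal.simps(1) ereal.inject)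
qed (simp_all add: subdiff_def)

lemma proper_fun_finite:
  assumes "proper_fun f" obtains x r where "f x = ereal r"
proof -
  obtain x where "f x \<noteq> \<infinity>" "f x \<noteq> -\<infinity>" using assms unfolding proper_fun_def by blast
  then show thesis using that by (cases "f x") auto
qed

lemma subdiff_monotone:
  assumes "s1 \<in> subdiff f x1" "s2 \<in> subdiff f x2"
  shows "0 \<le> (s1 - s2) \<bullet> (x1 - x2)"
proof -
  obtain r1 r2 where "f x1 = ereal r1" "f x2 = ereal r2"
    "ereal (r1 + s1 \<bullet> (x2 - x1)) \<le> f x2" "ereal (r2 + s2 \<bullet> (x1 - x2)) \<le> f x1"
    using assms unfolding subdiff_iff by metis
  then show ?thesis by (simp add: inner_simps)
qed

text \<open>
  The subgradient inequality at a fixed point \<open>z\<close> puts \<open>(x k, f z - s k \<bullet> (z - x k))\<close> into the epigraph,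
  and membership in the closed epigraph passes to the limit.
\<close>

lemma subdiff_closed_graph:
  assumes cl: "closed_fun f" and pr: "proper_fun f"
    and sub: "\<And>k::nat. s k \<in> subdiff f (x k)"
    and lim: "s \<longlonglongrightarrow> s'" "x \<longlonglongrightarrow> x'"
  shows "s' \<in> subdiff f x'"
proof -
  have *: "(x', t - s' \<bullet> (z - x')) \<in> epi f" if "f z \<le> ereal t" for z t
  proof -
    have "(x k, t - s k \<bullet> (z - x k)) \<in> epi f" for k
    proof -
      obtain r where "f (x k) = ereal r" "ereal (r + s k \<bullet> (z - x k)) \<le> f z"
        using sub[of k] unfolding subdiff_iff by blast
      moreover from this that have "ereal (r + s k \<bullet> (z - x k)) \<le> ereal t" using order_trans by blast
      ultimately show ?thesis by (simp add: epi_def)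
    qed
    moreover have "(\<lambda>k. (x k, t - s k \<bullet> (z - x k))) \<longlonglongrightarrow> (x', t - s' \<bullet> (z - x'))"
      by (intro tendsto_intros lim)
    ultimately show ?thesis
      by (rule closed_sequentially[OF cl[unfolded closed_fun_def]])
  qed
  obtain z0 t0 where "f z0 = ereal t0" using proper_fun_finite[OF pr] by blast
  with *[of z0 t0] have "f x' \<noteq> \<infinity>" by (auto simp: epi_def)
  with pr obtain r where r: "f x' = ereal r" by (cases "f x'") (auto simp: proper_fun_def)
  have "ereal (r + s' \<bullet> (z - x')) \<le> f z" for z
  proof (cases "f z")
    case (real t)
    with *[of z t] r show ?thesis by (simp add: epi_def)
  next
    case MInf
    with pr show ?thesis by (simp add: proper_fun_def)
  qed auto
  with r show ?thesis unfolding subdiff_iff by blast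
qed

text \<open>
  Graphs of subdifferentials are not convex in general.  When the monotonicity product of two
  elements of the graph vanishes, however, the two supporting affine functions agree at both base points, and convex
  combinations stay in the graph.
\<close>

lemma subdiff_segment:
  assumes cv: "convex_fun f" and s: "s1 \<in> subdiff f x1" "s2 \<in> subdiff f x2"
    and orth: "(s1 - s2) \<bullet> (x1 - x2) = 0" and t: "0 \<le> t" "t \<le> 1"
  shows "(1 - t) *\<^sub>R s1 + t *\<^sub>R s2 \<in> subdiff f ((1 - t) *\<^sub>R x1 + t *\<^sub>R x2)"
proof -
  let ?s = "(1 - t) *\<^sub>R s1 + t *\<^sub>R s2" and ?x = "(1 - t) *\<^sub>R x1 + t *\<^sub>R x2"
  obtain r1 r2 where r: "f x1 = ereal r1" "f x2 = ereal r2"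
    and i: "\<And>z. ereal (r1 + s1 \<bullet> (z - x1)) \<le> f z" "\<And>z. ereal (r2 + s2 \<bullet> (z - x2)) \<le> f z"
    using s unfolding subdiff_iff by metis
  let ?r = "(1 - t) * r1 + t * r2"
  have low: "ereal (?r + ?s \<bullet> (z - ?x)) \<le> f z" for z
  proof (cases "f z")
    case (real a)
    have "(1 - t) * (r1 + s1 \<bullet> (z - x1)) + t * (r2 + s2 \<bullet> (z - x2)) \<le> (1 - t) * a + t * a"
      using i[of z] real t by (intro add_mono mult_left_mono) auto
    moreover have "?s \<bullet> (z - ?x) = (1 - t) * (s1 \<bullet> (z - x1)) + t * (s2 \<bullet> (z - x2))
        + t * (1 - t) * ((s1 - s2) \<bullet> (x1 - x2))"
      by (simp add: algebra_simps)
    ultimately have "?r + ?s \<bullet> (z - ?x) \<le> a" unfolding orth by (simp add: algebra_simps)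
    with real show ?thesis by simp
  next
    case MInf
    with i(1)[of z] show ?thesis by simp
  qed auto
  have "(1 - t) *\<^sub>R (x1, r1) + t *\<^sub>R (x2, r2) \<in> epi f"
    using cv t r unfolding convex_fun_def by (intro convexD_alt) (auto simp: epi_def)
  then have "f ?x \<le> ereal ?r" by (simp add: epi_def)
  moreover have "ereal ?r \<le> f ?x" using low[of ?x] by simp
  ultimately have "f ?x = ereal ?r" by (rule antisym)
  with low show ?thesis unfolding subdiff_iff by blast
qed

lemma fenchel_young: "ereal (v \<bullet> x) - f x \<le> conjugate f v"
  unfolding conjugate_def by (rule SUP_upper) simp

lemma conjugate_leI:
  assumes "\<And>x. ereal (v \<bullet> x - t) \<le> f x"
  shows "conjugate f v \<le> ereal t"
  unfolding conjugate_def
proof (rule SUP_least)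
  fix x show "ereal (v \<bullet> x) - f x \<le> ereal t"
    using assms[of x] by (cases "f x") auto
qed

lemma conjugate_not_MInf:
  assumes "proper_fun f" shows "conjugate f v \<noteq> -\<infinity>"
proof -
  obtain x r where "f x = ereal r" using proper_fun_finite[OF assms] by blast
  with fenchel_young[of v x f] show ?thesis by auto
qed

lemma conjugate_le_real:
  assumes "proper_fun f" "conjugate f v \<le> ereal t"
  shows "ereal (v \<bullet> x - t) \<le> f x"
proof -
  have "ereal (v \<bullet> x) - f x \<le> ereal t" using fenchel_young assms(2) order_trans by blast
  moreover have "f x \<noteq> -\<infinity>" using assms(1) by (simp add: proper_fun_def)
  ultimately show ?thesis by (cases "f x") auto
qed

lemma conjugate_convex:
  assumes "proper_fun f" "conjugate f v \<le> ereal a" "conjugate f v' \<le> ereal a'" "0 \<le> t" "t \<le> 1"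
  shows "conjugate f (v + t *\<^sub>R (v' - v)) \<le> ereal (a + t * (a' - a))"
proof (rule conjugate_leI)
  fix x
  have "ereal (v \<bullet> x - a) \<le> f x" "ereal (v' \<bullet> x - a') \<le> f x"
    using conjugate_le_real assms by blast+
  then show "ereal ((v + t *\<^sub>R (v' - v)) \<bullet> x - (a + t * (a' - a))) \<le> f x"
  proof (cases "f x")
    case (real b)
    with \<open>ereal (v \<bullet> x - a) \<le> f x\<close> \<open>ereal (v' \<bullet> x - a') \<le> f x\<close>
    have "(1 - t) * (v \<bullet> x - a) + t * (v' \<bullet> x - a') \<le> (1 - t) * b + t * b"
      using assms by (intro add_mono mult_left_mono) auto
    with real show ?thesis by (simp add: algebra_simps)
  qed auto
qed

lemma subdiff_conjugate:
  assumes "proper_fun f" "v \<in> subdiff f s"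
  shows "s \<in> subdiff (conjugate f) v"
proof -
  obtain r where r: "f s = ereal r" and i: "\<And>z. ereal (r + v \<bullet> (z - s)) \<le> f z"
    using assms(2) unfolding subdiff_iff by blast
  have low: "ereal (v' \<bullet> s - r) \<le> conjugate f v'" for v'
    using fenchel_young[of v' s f] r by simp
  have "conjugate f v \<le> ereal (v \<bullet> s - r)"
    using i by (intro conjugate_leI) (simp add: algebra_simps)
  with low have "conjugate f v = ereal (v \<bullet> s - r)" by (simp add: antisym)
  with low show ?thesis unfolding subdiff_iff
    by (intro exI[of _ "v \<bullet> s - r"]) (simp add: inner_diff_right inner_commute)
qed

text \<open>
  The substantial half of the Fenchel--Moreau theorem, in the form needed here.  If the pair
  of \<open>s\<close> and the Fenchel value \<open>v \<bullet> s - r\<close> were not in the epigraph of \<open>f\<close>, a hyperplane would separate them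
  strictly.  A non-vertical hyperplane gives a point where the conjugate is below its supporting
  affine function with slope \<open>s\<close>; a vertical one gives a direction along which it grows too slowly.
  Either contradicts that \<open>s\<close> is a subgradient.
\<close>

lemma subdiff_conjugate_inverse:
  fixes f :: "'a::euclidean_space \<Rightarrow> ereal"
  assumes pr: "proper_fun f" and cl: "closed_fun f" and cv: "convex_fun f"
    and s: "s \<in> subdiff (conjugate f) v"
  shows "v \<in> subdiff f s"
proof -
  obtain r where r: "conjugate f v = ereal r"
    and i: "\<And>v'. ereal (r + s \<bullet> (v' - v)) \<le> conjugate f v'"
    using s unfolding subdiff_iff by blast
  let ?t = "v \<bullet> s - r"
  have below: "ereal (v \<bullet> z - r) \<le> f z" for z
    using conjugate_le_real[OF pr, of v r z] r by simp
  obtain z0 t0 where z0: "f z0 = ereal t0" using proper_fun_finite[OF pr] by blast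
  have "(s, ?t) \<in> epi f"
  proof (rule ccontr)
    assume "(s, ?t) \<notin> epi f"
    then have "\<exists>ab \<beta>. ab \<bullet> (s, ?t) < \<beta> \<and> (\<forall>q\<in>epi f. \<beta> < ab \<bullet> q)"
      using cl cv unfolding closed_fun_def convex_fun_def
      by (intro separating_hyperplane_closed_point)
    then obtain ab \<beta> where sep: "ab \<bullet> (s, ?t) < \<beta>" "\<And>q. q \<in> epi f \<Longrightarrow> \<beta> < ab \<bullet> q"
      by blast
    obtain a b where ab: "ab = (a, b)" by (cases ab)
    have sep1: "a \<bullet> s + b * ?t < \<beta>" using sep(1) ab by simp
    have sep2: "\<beta> < a \<bullet> z + b * t" if "f z \<le> ereal t" for z t
      using sep(2)[of "(z, t)"] that ab by (simp add: epi_def)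
    \<comment> \<open>The epigraph is unbounded upwards.\<close>
    have "b \<ge> 0"
    proof (rule ccontr)
      assume "\<not> b \<ge> 0"
      define t where "t = max t0 ((\<beta> - a \<bullet> z0) / b)"
      have "\<beta> < a \<bullet> z0 + b * t" by (rule sep2) (simp add: z0 t_def)
      moreover have "b * t \<le> b * ((\<beta> - a \<bullet> z0) / b)"
        using \<open>\<not> b \<ge> 0\<close> by (intro mult_left_mono_neg) (auto simp: t_def)
      ultimately show False using \<open>\<not> b \<ge> 0\<close> by simp
    qed
    show False
    proof (cases "b = 0")
      case True
      have "conjugate f (v - n *\<^sub>R a) \<le> ereal (r - n * \<beta>)" if "n \<ge> 0" for n :: real
      proof (rule conjugate_leI)
        fix z
        show "ereal ((v - n *\<^sub>R a) \<bullet> z - (r - n * \<beta>)) \<le> f z"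
        proof (cases "f z")
          case (real c)
          with sep2[of z c] True have "n * \<beta> \<le> n * (a \<bullet> z)" using that by (simp add: mult_left_mono)
          with below[of z] real show ?thesis by (simp add: inner_simps)
        next
          case MInf
          with below[of z] show ?thesis by simp
        qed auto
      qed
      \<comment> \<open>A unit step against the normal already contradicts the subgradient inequality.\<close>
      from order_trans[OF i this[of 1]] sep1 True show False by (simp add: inner_simps inner_commute)
    next
      case False
      with \<open>b \<ge> 0\<close> have b: "b > 0" by simp
      let ?v = "- (1 / b) *\<^sub>R a"
      have "conjugate f ?v \<le> ereal (- \<beta> / b)"
      proof (rule conjugate_leI)
        fix z
        show "ereal (?v \<bullet> z - (- \<beta> / b)) \<le> f z"
        proof (cases "f z")
          case (real c)
          with sep2[of z c] b show ?thesis by (simp add: field_simps)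
        next
          case MInf
          with below[of z] show ?thesis by simp
        qed auto
      qed
      from order_trans[OF i this] have "r + s \<bullet> (?v - v) \<le> - \<beta> / b" by simp
      then have "b * (r + s \<bullet> (?v - v)) \<le> b * (- \<beta> / b)" using b by (intro mult_left_mono) auto
      with sep1 b show False by (simp add: inner_simps inner_commute algebra_simps)
    qed
  qed
  then have "f s \<le> ereal ?t" by (simp add: epi_def)
  with below[of s] have "f s = ereal ?t" by (simp add: antisym)
  then show ?thesis unfolding subdiff_iff using below
    by (intro exI[of _ ?t]) (simp add: inner_simps)
qed


section \<open>Halpern iteration in a seminorm\<close>

text \<open>
  The recursion telescopes, so \<open>(k + 1) D k\<close> is bounded by a sum of the errors and \<open>D\<close> by their
  Cesaro mean.
\<close>

lemma weighted_recursion_tendsto_0: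
  fixes D \<epsilon> :: "nat \<Rightarrow> real"
  assumes nn: "\<And>k. 0 \<le> D k"
    and rec: "\<And>k. (real k + 2) * D (Suc k) \<le> (real k + 1) * D k + \<epsilon> k"
    and small: "\<And>e. e > 0 \<Longrightarrow> eventually (\<lambda>k. \<epsilon> k \<le> e) sequentially"
  shows "D \<longlonglongrightarrow> 0"
proof (rule LIMSEQ_I)
  fix r :: real assume r: "r > 0"
  obtain N where N: "\<And>k. k \<ge> N \<Longrightarrow> \<epsilon> k \<le> r / 4"
    using small[of "r / 4"] r unfolding eventually_sequentially by auto
  have bound: "(real (N + j) + 1) * D (N + j) \<le> (real N + 1) * D N + real j * (r / 4)" for j
  proof (induction j)
    case (Suc j)
    have "(real (N + Suc j) + 1) * D (N + Suc j) \<le> (real (N + j) + 1) * D (N + j) + \<epsilon> (N + j)"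
      using rec[of "N + j"] by (simp add: add_ac)
    with Suc N[of "N + j"] have "(real (N + Suc j) + 1) * D (N + Suc j)
        \<le> (real N + 1) * D N + (real j * (r / 4) + r / 4)" by linarith
    then show ?case by (simp add: field_simps)
  qed simp
  obtain J where J: "real J * (r / 4) \<ge> (real N + 1) * D N"
    using reals_Archimedean3[of "r / 4"] r by (metis less_imp_le zero_less_divide_iff zero_less_numeral)
  have "D n < r" if n: "n \<ge> N + J" for n
  proof -
    define j where "j = n - N"
    have n': "n = N + j" "j \<ge> J" using n by (auto simp: j_def)
    have "(real n + 1) * D n \<le> (real N + 1) * D N + real j * (r / 4)" using bound[of j] n' by simp
    also have "\<dots> \<le> real J * (r / 4) + real j * (r / 4)" using J by simp
    also have "\<dots> \<le> (real n + 1) * (r / 4) + (real n + 1) * (r / 4)"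
      using r n' by (intro add_mono mult_right_mono) auto
    also have "\<dots> = (real n + 1) * (r / 2)" by simp
    finally have "D n \<le> r / 2" by simp
    with r show ?thesis by simp
  qed
  then show "\<exists>no. \<forall>n\<ge>no. norm (D n - 0) < r" using nn by (auto intro!: exI[of _ "N + J"])
qed

text \<open>
  \<open>ub (Suc k)\<close> plays the role of the resolvent value at \<open>u k\<close>.  Only its values along the sequence are
  assumed, through the two consequences \<open>mono\<close> and \<open>mono_zero\<close> of the monotonicity of an underlying operator: the
  algorithms are given by their iterates, and a resolvent need not be defined elsewhere.
\<close>

locale halpern_resolvent =
  fixes M :: "'a::euclidean_space \<Rightarrow> 'a" and u ub :: "nat \<Rightarrow> 'a" and Z :: "'a set"
  assumes sa: "self_adjoint M" and psd: "pos_semidef M"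
    and update: "\<And>k. u (Suc k) = halpern_update k (u 0) (u k) (ub (Suc k))"
    and mono: "\<And>j k. 0 \<le> (ub (Suc j) - ub (Suc k)) \<bullet> M ((u j - ub (Suc j)) - (u k - ub (Suc k)))"
    and mono_zero: "\<And>j p. p \<in> Z \<Longrightarrow> 0 \<le> (ub (Suc j) - p) \<bullet> M (u j - ub (Suc j))"
    and Z_ne: "Z \<noteq> {}"
begin

text \<open>
  \<open>a\<close> stands for a difference of points and \<open>b\<close> for the difference of their resolvent values; the
  hypothesis is then firm nonexpansiveness, and the conclusions are the nonexpansiveness of the
  reflection and of the resolvent.
\<close>

lemma reflection_le:
  assumes "0 \<le> b \<bullet> M (a - b)"
  shows "op_norm M (2 *\<^sub>R b - a) \<le> op_norm M a" "op_norm M b \<le> op_norm M a"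
proof -
  have lin: "linear M" using sa by (rule self_adjoint_linear)
  have s: "b \<bullet> M a = a \<bullet> M b" using self_adjoint_swap[OF sa, of b a] by (simp add: inner_commute)
  have pos: "0 \<le> (a - b) \<bullet> M (a - b)" using psd by (simp add: pos_semidef_def)
  have dec: "b \<bullet> M b \<le> a \<bullet> M a"
    using assms pos s by (simp add: linear_diff[OF lin] inner_simps)
  have "(2 *\<^sub>R b - a) \<bullet> M (2 *\<^sub>R b - a) \<le> a \<bullet> M a"
    using assms s by (simp add: linear_diff[OF lin] linear_cmul[OF lin] inner_simps)
  then show "op_norm M (2 *\<^sub>R b - a) \<le> op_norm M a" by (simp add: op_norm_def)
  show "op_norm M b \<le> op_norm M a" using dec by (simp add: op_norm_def)
qed

definition "reflected k = 2 *\<^sub>R ub (Suc k) - u k"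

lemma update_reflect:
  "u (Suc k) = (1 / (real k + 2)) *\<^sub>R u 0 + ((real k + 1) / (real k + 2)) *\<^sub>R reflected k"
  by (simp add: update halpern_update_def reflected_def)

lemma reflect_nonexpansive: "op_norm M (reflected j - reflected k) \<le> op_norm M (u j - u k)"
proof -
  have "reflected j - reflected k = 2 *\<^sub>R (ub (Suc j) - ub (Suc k)) - (u j - u k)"
    by (simp add: reflected_def algebra_simps)
  moreover have "0 \<le> (ub (Suc j) - ub (Suc k)) \<bullet> M ((u j - u k) - (ub (Suc j) - ub (Suc k)))"
    using mono[of j k] by (simp add: algebra_simps)
  ultimately show ?thesis using reflection_le(1) by metis
qed

lemma reflect_le_zero:
  assumes "p \<in> Z"
  shows "op_norm M (reflected k - p) \<le> op_norm M (u k - p)"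
    "op_norm M (ub (Suc k) - p) \<le> op_norm M (u k - p)"
proof -
  have *: "0 \<le> (ub (Suc k) - p) \<bullet> M ((u k - p) - (ub (Suc k) - p))"
    using mono_zero[OF assms, of k] by (simp add: algebra_simps)
  have "reflected k - p = 2 *\<^sub>R (ub (Suc k) - p) - (u k - p)"
    by (simp add: reflected_def algebra_simps scaleR_2)
  then show "op_norm M (reflected k - p) \<le> op_norm M (u k - p)" using reflection_le(1)[OF *] by simp
  show "op_norm M (ub (Suc k) - p) \<le> op_norm M (u k - p)" using reflection_le(2)[OF *] .
qed

text \<open>
  Clearing denominators keeps the later computations free of divisions.
\<close>

lemma scaled_step: "(real k + 2) *\<^sub>R u (Suc k) = u 0 + (real k + 1) *\<^sub>R reflected k"
  unfolding update_reflect by (simp add: scaleR_add_right)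

lemma scaled_step_seminorm: "(real k + 2) * op_norm M (u (Suc k) - p)
    \<le> op_norm M (u 0 - p) + (real k + 1) * op_norm M (reflected k - p)"
proof -
  have "(real k + 2) *\<^sub>R (u (Suc k) - p) = (u 0 - p) + (real k + 1) *\<^sub>R (reflected k - p)"
    using scaled_step[of k] by (simp add: algebra_simps scaleR_2)
  then have "op_norm M ((real k + 2) *\<^sub>R (u (Suc k) - p))
      \<le> op_norm M (u 0 - p) + op_norm M ((real k + 1) *\<^sub>R (reflected k - p))"
    using op_norm_triangle[OF sa psd] by metis
  then show ?thesis by (simp add: op_norm_scaleR[OF self_adjoint_linear[OF sa]])
qed

lemma iterates_bounded:
  assumes "p \<in> Z" shows "op_norm M (u k - p) \<le> op_norm M (u 0 - p)"
proof (induction k)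
  case (Suc k)
  have "(real k + 2) * op_norm M (u (Suc k) - p) \<le> op_norm M (u 0 - p) + (real k + 1) * op_norm M (u 0 - p)"
    using scaled_step_seminorm[of k p] reflect_le_zero(1)[OF assms, of k] Suc
    by (smt (verit, best) mult_left_mono of_nat_0_le_iff)
  also have "\<dots> = (real k + 2) * op_norm M (u 0 - p)" by (simp add: algebra_simps)
  finally show ?case by simp
qed simp

lemma resolvents_bounded:
  assumes "p \<in> Z" shows "op_norm M (ub (Suc k) - p) \<le> op_norm M (u 0 - p)"
  using reflect_le_zero(2)[OF assms, of k] iterates_bounded[OF assms, of k] by linarith

lemma reflect_dist_bounded:
  obtains C where "C \<ge> 0" "\<And>k. op_norm M (u 0 - reflected k) \<le> C"
proof -
  obtain p where p: "p \<in> Z" using Z_ne by blast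
  have "op_norm M (u 0 - reflected k) \<le> 2 * op_norm M (u 0 - p)" for k
  proof -
    have "op_norm M ((u 0 - p) + (- 1) *\<^sub>R (reflected k - p)) \<le> op_norm M (u 0 - p) + op_norm M (reflected k - p)"
      using op_norm_triangle[OF sa psd] op_norm_scaleR[OF self_adjoint_linear[OF sa], of "-1"]
      by (metis abs_minus_cancel abs_one mult_1)
    with reflect_le_zero(1)[OF p, of k] iterates_bounded[OF p, of k] show ?thesis by simp
  qed
  with that[of "2 * op_norm M (u 0 - p)"] op_norm_nonneg[OF psd] show thesis by simp
qed

text \<open>
  Two consecutive updates use almost the same anchor weight.  Their difference is at most
  \<open>(k + 2) / (k + 3)\<close> times the previous one plus an error of order \<open>1 / k\<^sup>2\<close>, and
  the weighted recursion applies.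
\<close>

lemma successive_difference_tendsto_0: "(\<lambda>k. op_norm M (u (Suc k) - u k)) \<longlonglongrightarrow> 0"
proof -
  note lin = self_adjoint_linear[OF sa]
  obtain C where C: "C \<ge> 0" "\<And>k. op_norm M (u 0 - reflected k) \<le> C" using reflect_dist_bounded by blast
  let ?\<Delta> = "\<lambda>k. op_norm M (u (Suc k) - u k)"
  \<comment> \<open>This factor shifts the weights \<open>k + 3\<close> and \<open>k + 2\<close> of the recursion for the differences to
    \<open>k + 2\<close> and \<open>k + 1\<close>.\<close>
  let ?D = "\<lambda>k. (real k + 2) / (real k + 1) * ?\<Delta> k"
  have identity: "a *\<^sub>R ((a + 1) *\<^sub>R (v'' - v')) = a *\<^sub>R (a *\<^sub>R (r' - r)) + (- 1) *\<^sub>R (v - r)"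
    if "(a + 1) *\<^sub>R v'' = v + a *\<^sub>R r'" "a *\<^sub>R v' = v + (a - 1) *\<^sub>R r" for a :: real and v v' v'' r r' :: 'a
  proof -
    have "a *\<^sub>R ((a + 1) *\<^sub>R (v'' - v')) = a *\<^sub>R ((a + 1) *\<^sub>R v'') - (a + 1) *\<^sub>R (a *\<^sub>R v')"
      by (simp add: algebra_simps)
    also have "\<dots> = a *\<^sub>R (v + a *\<^sub>R r') - (a + 1) *\<^sub>R (v + (a - 1) *\<^sub>R r)"
      unfolding that ..
    also have "\<dots> = a *\<^sub>R (a *\<^sub>R (r' - r)) + (- 1) *\<^sub>R (v - r)"
      by (simp add: algebra_simps)
    finally show ?thesis .
  qed
  have rec: "(real k + 3) * ?\<Delta> (Suc k) \<le> (real k + 2) * ?\<Delta> k + C / (real k + 2)" for k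
  proof -
    let ?a = "real k + 2"
    have "(?a + 1) *\<^sub>R u (Suc (Suc k)) = u 0 + ?a *\<^sub>R reflected (Suc k)"
      using scaled_step[of "Suc k"] by (simp add: add_ac)
    moreover have "?a *\<^sub>R u (Suc k) = u 0 + (?a - 1) *\<^sub>R reflected k"
      using scaled_step[of k] by (simp add: add_ac)
    ultimately have "?a *\<^sub>R ((?a + 1) *\<^sub>R (u (Suc (Suc k)) - u (Suc k)))
        = ?a *\<^sub>R (?a *\<^sub>R (reflected (Suc k) - reflected k)) + (- 1) *\<^sub>R (u 0 - reflected k)"
      by (rule identity)
    then have "op_norm M (?a *\<^sub>R ((?a + 1) *\<^sub>R (u (Suc (Suc k)) - u (Suc k))))
        \<le> op_norm M (?a *\<^sub>R (?a *\<^sub>R (reflected (Suc k) - reflected k))) + op_norm M ((- 1) *\<^sub>R (u 0 - reflected k))"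
      using op_norm_triangle[OF sa psd] by metis
    then have "?a * ((?a + 1) * ?\<Delta> (Suc k))
        \<le> ?a * (?a * op_norm M (reflected (Suc k) - reflected k)) + op_norm M (u 0 - reflected k)"
      unfolding op_norm_scaleR[OF lin] by simp
    also have "\<dots> \<le> ?a * (?a * ?\<Delta> k) + C"
      by (intro add_mono mult_left_mono reflect_nonexpansive C) auto
    also have "\<dots> = ?a * (?a * ?\<Delta> k + C / ?a)" by (simp add: field_simps)
    finally show ?thesis by (simp add: add_ac)
  qed
  have "?D \<longlonglongrightarrow> 0"
  proof (rule weighted_recursion_tendsto_0)
    show "0 \<le> ?D k" for k using op_norm_nonneg[OF psd] by simp
    show "(real k + 2) * ?D (Suc k) \<le> (real k + 1) * ?D k + C / (real k + 2)" for k
      using rec[of k] by (simp add: add_ac)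
    have "(\<lambda>k. C / (real k + 2)) \<longlonglongrightarrow> 0" by real_asymp
    then show "eventually (\<lambda>k. C / (real k + 2) \<le> e) sequentially" if "e > 0" for e
      using order_tendstoD(2)[OF _ that] by (fastforce elim: eventually_mono)
  qed
  then show ?thesis
  proof (rule tendsto_sandwich[OF _ _ tendsto_const, rotated 2])
    show "eventually (\<lambda>k. ?\<Delta> k \<le> ?D k) sequentially"
    proof (rule always_eventually, rule allI)
      fix k
      have "1 * ?\<Delta> k \<le> ?D k" using op_norm_nonneg[OF psd] by (intro mult_right_mono) auto
      then show "?\<Delta> k \<le> ?D k" by simp
    qed
  qed (simp add: op_norm_nonneg[OF psd])
qed

text \<open>
  \<open>2 (u - ub)\<close> is \<open>u\<close> minus its reflection, and the next iterate differs from that reflection by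
  a term of order \<open>1 / k\<close>.
\<close>

lemma residual_tendsto_0: "(\<lambda>k. op_norm M (u k - ub (Suc k))) \<longlonglongrightarrow> 0"
proof -
  note lin = self_adjoint_linear[OF sa]
  obtain C where C: "C \<ge> 0" "\<And>k. op_norm M (u 0 - reflected k) \<le> C" using reflect_dist_bounded by blast
  have bound: "2 * op_norm M (u k - ub (Suc k)) \<le> op_norm M (u (Suc k) - u k) + C / (real k + 2)" for k
  proof -
    have "(real k + 2) *\<^sub>R (u (Suc k) - reflected k) = u 0 - reflected k"
      using scaled_step[of k] by (simp add: algebra_simps scaleR_2)
    then have "(real k + 2) * op_norm M (u (Suc k) - reflected k) = op_norm M (u 0 - reflected k)"
      using op_norm_scaleR[OF lin, of "real k + 2"] by (metis abs_of_nonneg of_nat_0_le_iff add_nonneg_nonneg zero_le_numeral)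
    with C(2)[of k] have "op_norm M (u (Suc k) - reflected k) \<le> C / (real k + 2)"
      by (simp add: field_simps)
    moreover have "2 *\<^sub>R (u k - ub (Suc k)) = (- 1) *\<^sub>R (u (Suc k) - u k) + (u (Suc k) - reflected k)"
      by (simp add: reflected_def algebra_simps scaleR_2)
    then have "op_norm M (2 *\<^sub>R (u k - ub (Suc k)))
        \<le> op_norm M ((- 1) *\<^sub>R (u (Suc k) - u k)) + op_norm M (u (Suc k) - reflected k)"
      using op_norm_triangle[OF sa psd] by metis
    ultimately show ?thesis unfolding op_norm_scaleR[OF lin] by simp
  qed
  have "(\<lambda>k. C / (real k + 2)) \<longlonglongrightarrow> 0" by real_asymp
  from tendsto_add[OF successive_difference_tendsto_0 this]
  have lim: "(\<lambda>k. op_norm M (u (Suc k) - u k) + C / (real k + 2)) \<longlonglongrightarrow> 0" by simp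
  show ?thesis
  proof (rule tendsto_sandwich[OF _ _ tendsto_const lim])
    show "eventually (\<lambda>k. op_norm M (u k - ub (Suc k)) \<le> op_norm M (u (Suc k) - u k) + C / (real k + 2)) sequentially"
      using bound op_norm_nonneg[OF psd] by (intro always_eventually allI) (smt (verit))
  qed (simp add: op_norm_nonneg[OF psd])
qed

text \<open>
  Expanding the square of \<open>(k + 2) (u\<^sup>k\<^sup>+\<^sup>1 - p) = (u\<^sup>0 - p) + (k + 1) (reflection - p)\<close> leaves a
  recursion whose error term is the inner product in the second hypothesis.
\<close>

lemma iterates_tendsto:
  assumes p: "p \<in> Z"
    and limsup: "\<And>e. e > 0 \<Longrightarrow> eventually (\<lambda>k. (u 0 - p) \<bullet> M (u k - p) \<le> e) sequentially"
  shows "(\<lambda>k. op_norm M (u k - p)) \<longlonglongrightarrow> 0"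
proof -
  note lin = self_adjoint_linear[OF sa]
  have "(\<lambda>k. (op_norm M (u k - p))\<^sup>2) \<longlonglongrightarrow> 0"
  proof (rule weighted_recursion_tendsto_0)
    fix k
    let ?a = "u 0 - p" and ?b = "(real k + 1) *\<^sub>R (reflected k - p)"
    let ?D = "\<lambda>k. (op_norm M (u k - p))\<^sup>2" and ?c = "real k + 2"
    have ab: "?a + ?b = ?c *\<^sub>R (u (Suc k) - p)"
      using scaled_step[of k] by (simp add: algebra_simps scaleR_2)
    have "(?a + ?b) \<bullet> M (?a + ?b) \<le> ?b \<bullet> M ?b + 2 * (?a \<bullet> M (?a + ?b))"
      using psd[unfolded pos_semidef_def, rule_format, of ?a]
      unfolding form_sum[OF sa, of ?a ?b] by (simp add: linear_add[OF lin] inner_add_right)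
    moreover have sc: "(t *\<^sub>R v) \<bullet> M (t *\<^sub>R v) = t\<^sup>2 * (op_norm M v)\<^sup>2" for t v
      unfolding op_norm_sq[OF psd] by (simp add: linear_cmul[OF lin] power2_eq_square)
    ultimately
    have "?c\<^sup>2 * ?D (Suc k) \<le> (real k + 1)\<^sup>2 * (op_norm M (reflected k - p))\<^sup>2
        + 2 * ?c * (?a \<bullet> M (u (Suc k) - p))"
      unfolding ab sc by (simp only: linear_cmul[OF lin] inner_scaleR_right mult.assoc)
    also have "\<dots> \<le> (real k + 1)\<^sup>2 * ?D k + 2 * ?c * (?a \<bullet> M (u (Suc k) - p))"
      using reflect_le_zero(1)[OF p, of k] op_norm_nonneg[OF psd]
      by (intro add_mono mult_left_mono power_mono) auto
    also have "\<dots> \<le> ?c * (real k + 1) * ?D k + 2 * ?c * (?a \<bullet> M (u (Suc k) - p))"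
      by (intro add_right_mono mult_right_mono) (auto simp: power2_eq_square)
    finally have "?c * (?c * ?D (Suc k)) \<le> ?c * ((real k + 1) * ?D k + 2 * (?a \<bullet> M (u (Suc k) - p)))"
      by (simp add: power2_eq_square algebra_simps)
    then show "?c * ?D (Suc k) \<le> (real k + 1) * ?D k + 2 * (?a \<bullet> M (u (Suc k) - p))"
      by simp
  next
    fix e :: real assume "e > 0"
    with limsup[of "e / 2"] have "eventually (\<lambda>k. (u 0 - p) \<bullet> M (u k - p) \<le> e / 2) sequentially" by simp
    then have "eventually (\<lambda>k. (u 0 - p) \<bullet> M (u (Suc k) - p) \<le> e / 2) sequentially"
      by (rule eventually_sequentially_Suc[of "\<lambda>k. (u 0 - p) \<bullet> M (u k - p) \<le> e / 2", THEN iffD2])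
    then show "eventually (\<lambda>k. 2 * ((u 0 - p) \<bullet> M (u (Suc k) - p)) \<le> e) sequentially"
      by (rule eventually_mono) simp
  qed simp
  from tendsto_real_sqrt[OF this] show ?thesis by (simp add: op_norm_nonneg[OF psd])
qed

end


section \<open>The KKT operator and the preconditioner\<close>

lemma tendsto_linear:
  fixes f :: "'b::euclidean_space \<Rightarrow> 'c::real_normed_vector"
  assumes "linear f" "(g \<longlongrightarrow> l) F" shows "((\<lambda>k. f (g k)) \<longlongrightarrow> f l) F"
  using bounded_linear.tendsto[OF linear_conv_bounded_linear[THEN iffD1, OF assms(1)] assms(2)] .

locale composite_qp =
  fixes Q :: "real^'n \<Rightarrow> real^'n" and A :: "real^'n \<Rightarrow> real^'m" and c :: "real^'n"
    and \<phi> :: "real^'n \<Rightarrow> ereal" and K :: "(real^'m) set"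
    and \<sigma> lamQ :: real and Sy :: "real^'m \<Rightarrow> real^'m"
  assumes Q_sa: "self_adjoint Q" and Q_psd: "pos_semidef Q"
    and A_lin: "linear A"
    and phi: "proper_fun \<phi>" "closed_fun \<phi>" "convex_fun \<phi>"
    and ind_K: "proper_fun (ind_fun K)" "closed_fun (ind_fun K)" "convex_fun (ind_fun K)"
    and sigma_pos: "\<sigma> > 0" and lamQ_pos: "lamQ > 0"
    and Q_le: "\<And>w. w \<bullet> Q w \<le> lamQ * (w \<bullet> w)"
    and Sy_sa: "self_adjoint Sy" and Sy_psd: "pos_semidef Sy"
    and nondegenerate: "pos_def (\<lambda>y. Sy y + A (adjoint A y))"
begin

abbreviation "B \<equiv> adjoint A"
abbreviation "\<tau> \<equiv> \<sigma>\<^sup>2 / (1 + \<sigma> * lamQ)"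
abbreviation "denom \<equiv> 1 + \<sigma> * lamQ"

lemma denom_pos: "denom > 0"
  using sigma_pos lamQ_pos by (simp add: add_pos_pos)

lemmas Q_lin = self_adjoint_linear[OF Q_sa]
lemmas Sy_lin = self_adjoint_linear[OF Sy_sa]
lemmas B_lin = adjoint_linear[OF A_lin]

lemmas lin_simps =
  linear_add[OF Q_lin] linear_diff[OF Q_lin] linear_cmul[OF Q_lin] linear_neg[OF Q_lin] linear_0[OF Q_lin]
  linear_add[OF A_lin] linear_diff[OF A_lin] linear_cmul[OF A_lin] linear_neg[OF A_lin] linear_0[OF A_lin]
  linear_add[OF B_lin] linear_diff[OF B_lin] linear_cmul[OF B_lin] linear_neg[OF B_lin] linear_0[OF B_lin]
  linear_add[OF Sy_lin] linear_diff[OF Sy_lin] linear_cmul[OF Sy_lin] linear_neg[OF Sy_lin] linear_0[OF Sy_lin]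

lemma inner_Q: "a \<bullet> Q b = Q a \<bullet> b"
  using self_adjoint_swap[OF Q_sa] by simp

lemma inner_A: "y \<bullet> A v = B y \<bullet> v"
  using adjoint_works[OF A_lin, of v y] by (simp add: inner_commute)

lemma inner_Sy: "a \<bullet> Sy b = Sy a \<bullet> b"
  using self_adjoint_swap[OF Sy_sa] by simp

text \<open>
  \<open>kkt_op u e\<close> means \<open>e \<in> T u\<close>.  The subdifferentials are those of \<open>\<phi>\<close> and of the indicator of \<open>K\<close>, inverted
  from those of the conjugates; this is why \<open>ey\<close> and \<open>ez\<close> appear inside the arguments.
\<close>

definition kkt_op :: "('m, 'n) state \<Rightarrow> ('m, 'n) state \<Rightarrow> bool" where
  "kkt_op u e \<longleftrightarrow> (case u of (y, w, z, x) \<Rightarrow> case e of (ey, ew, ez, ex) \<Rightarrow>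
     - y \<in> subdiff (ind_fun K) (A x - ey) \<and>
     ew = Q w - Q x \<and>
     - z \<in> subdiff \<phi> (x - ez) \<and>
     ex = Q w - B y - z + c)"

text \<open>
  The preconditioner \<open>prec\<close> sees \<open>w\<close> only through \<open>v = Q w\<close>.  Factoring it through \<open>precQ\<close> makes convergence of
  \<open>Q w\<close>, the only convergence available in this component, sufficient for that of \<open>prec u\<close>.
\<close>

definition precQ :: "('m, 'n) state \<Rightarrow> ('m, 'n) state" where
  "precQ = (\<lambda>(y, v, z, x).
     (A x - \<sigma> *\<^sub>R A v + \<sigma> *\<^sub>R A (B y) + \<tau> *\<^sub>R A (Q (B y)) + \<sigma> *\<^sub>R Sy y,
      (\<sigma> * lamQ) *\<^sub>R v - Q x - \<sigma> *\<^sub>R Q (B y),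
      0,
      (1 / \<sigma>) *\<^sub>R x - v + B y))"

definition prec :: "('m, 'n) state \<Rightarrow> ('m, 'n) state" where
  "prec u = precQ (apply_Q Q u)"

lemma precQ_linear: "linear precQ"
  by (rule linearI)
     (auto simp: precQ_def lin_simps algebra_simps)

lemma apply_Q_linear: "linear (apply_Q Q :: ('m, 'n) state \<Rightarrow> ('m, 'n) state)"
  by (rule linearI) (auto simp: apply_Q_def lin_simps)

lemma prec_linear: "linear prec"
  using linear_compose[OF apply_Q_linear precQ_linear] by (simp add: prec_def[abs_def] o_def)

text \<open>
  Completing the square in \<open>x\<close> exhibits the form of \<open>prec\<close> as a sum of visibly symmetric, positive
  semidefinite terms.
\<close>

lemma prec_form:
  "(y, w, z, x) \<bullet> prec (y', w', z', x') =
     \<sigma> * (((1 / \<sigma>) *\<^sub>R x + B y - Q w) \<bullet> ((1 / \<sigma>) *\<^sub>R x' + B y' - Q w'))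
     + \<sigma> * (lamQ * (w \<bullet> Q w') - Q w \<bullet> Q w')
     + \<tau> * (B y \<bullet> Q (B y')) + \<sigma> * (y \<bullet> Sy y')"
proof -
  have "\<sigma> * (((1 / \<sigma>) *\<^sub>R x + B y - Q w) \<bullet> ((1 / \<sigma>) *\<^sub>R x' + B y' - Q w'))
     = (x + \<sigma> *\<^sub>R B y - \<sigma> *\<^sub>R Q w) \<bullet> ((1 / \<sigma>) *\<^sub>R x' + B y' - Q w')"
    using sigma_pos by (simp add: inner_add_left inner_diff_left algebra_simps)
  then show ?thesis using sigma_pos
    by (simp add: prec_def precQ_def apply_Q_def inner_simps inner_A inner_Q lin_simps algebra_simps)
qed

lemma prec_self_adjoint: "self_adjoint prec"
proof (rule self_adjointI[OF prec_linear])
  fix a b :: "('m, 'n) state"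
  obtain y w z x y' w' z' x' where ab: "a = (y, w, z, x)" "b = (y', w', z', x')"
    by (metis prod_cases4)
  have "b \<bullet> prec a = a \<bullet> prec b"
    unfolding ab prec_form
    using inner_Q[of w w'] inner_Q[of "B y" "B y'"] inner_Sy[of y y']
    by (simp add: inner_commute)
  then show "prec a \<bullet> b = a \<bullet> prec b" by (simp add: inner_commute)
qed

lemma prec_psd: "pos_semidef prec"
  unfolding pos_semidef_def
proof
  fix a :: "('m, 'n) state"
  obtain y w z x where a: "a = (y, w, z, x)" by (metis prod_cases4)
  have "Q w \<bullet> Q w \<le> lamQ * (w \<bullet> Q w)" using psd_square_le[OF Q_sa Q_psd Q_le] .
  moreover have "0 \<le> y \<bullet> Sy y" "0 \<le> B y \<bullet> Q (B y)"
    using Sy_psd Q_psd by (auto simp: pos_semidef_def)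
  moreover have "0 \<le> \<tau>" using sigma_pos denom_pos by simp
  ultimately show "0 \<le> a \<bullet> prec a"
    unfolding a prec_form using sigma_pos by (intro add_nonneg_nonneg mult_nonneg_nonneg) auto
qed

lemma kkt_op_proj:
  "kkt_op u e \<longleftrightarrow>
     - fst u \<in> subdiff (ind_fun K) (A (snd (snd (snd u))) - fst e) \<and>
     fst (snd e) = Q (fst (snd u)) - Q (snd (snd (snd u))) \<and>
     - fst (snd (snd u)) \<in> subdiff \<phi> (snd (snd (snd u)) - fst (snd (snd e))) \<and>
     snd (snd (snd e)) = Q (fst (snd u)) - B (fst u) - fst (snd (snd u)) + c"
  by (simp add: kkt_op_def case_prod_beta)

text \<open>
  The coupling between \<open>(y, w, z)\<close> and \<open>x\<close> is skew, so that the product splits into those of the two subdifferentials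
  and the form of \<open>Q\<close>.
\<close>

lemma kkt_op_monotone:
  assumes "kkt_op u e" "kkt_op u' e'"
  shows "0 \<le> (u - u') \<bullet> (e - e')"
proof -
  obtain y w z x ey ew ez ex where u: "u = (y, w, z, x)" "e = (ey, ew, ez, ex)" by (metis prod_cases4)
  obtain y' w' z' x' ey' ew' ez' ex' where u': "u' = (y', w', z', x')" "e' = (ey', ew', ez', ex')"
    by (metis prod_cases4)
  have a: "- y \<in> subdiff (ind_fun K) (A x - ey)" "ew = Q w - Q x"
     "- z \<in> subdiff \<phi> (x - ez)" "ex = Q w - B y - z + c"
    using assms(1) by (auto simp: u kkt_op_def)
  have b: "- y' \<in> subdiff (ind_fun K) (A x' - ey')" "ew' = Q w' - Q x'"
     "- z' \<in> subdiff \<phi> (x' - ez')" "ex' = Q w' - B y' - z' + c"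
    using assms(2) by (auto simp: u' kkt_op_def)
  define dy dw dz dx where d: "dy = y - y'" "dw = w - w'" "dz = z - z'" "dx = x - x'"
  have "0 \<le> (- dy) \<bullet> (A dx - (ey - ey'))"
    using subdiff_monotone[OF a(1) b(1)] by (simp add: d lin_simps algebra_simps)
  moreover have "0 \<le> (- dz) \<bullet> (dx - (ez - ez'))"
    using subdiff_monotone[OF a(3) b(3)] by (simp add: d algebra_simps)
  moreover have "0 \<le> dw \<bullet> Q dw" using Q_psd by (simp add: pos_semidef_def)
  moreover have "ew - ew' = Q dw - Q dx" "ex - ex' = Q dw - B dy - dz"
    by (simp_all add: a b d lin_simps algebra_simps)
  moreover have "dw \<bullet> Q dx = dx \<bullet> Q dw" "dx \<bullet> B dy = dy \<bullet> A dx" "dx \<bullet> dz = dz \<bullet> dx"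
    using inner_Q[of dw dx] inner_A[of dy dx] by (simp_all add: inner_commute)
  moreover have "(u - u') \<bullet> (e - e') = dy \<bullet> (ey - ey') + dw \<bullet> (ew - ew') + dz \<bullet> (ez - ez') + dx \<bullet> (ex - ex')"
    by (simp add: u u' d)
  ultimately show ?thesis by (simp add: inner_diff_right)
qed

text \<open>
  Only \<open>Q w\<close> has to converge, since \<open>w\<close> enters the KKT operator through \<open>Q w\<close> alone.
\<close>

lemma kkt_op_closed:
  fixes u :: "nat \<Rightarrow> ('m, 'n) state"
  assumes "\<And>k. kkt_op (u k) (e k)" "(\<lambda>k. apply_Q Q (u k)) \<longlonglongrightarrow> apply_Q Q u'" "e \<longlonglongrightarrow> e'"
  shows "kkt_op u' e'"
proof -
  note lim = assms(2)[unfolded apply_Q_def case_prod_beta]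
  have y: "(\<lambda>k. fst (u k)) \<longlonglongrightarrow> fst u'" using tendsto_fst[OF lim] by simp
  have w: "(\<lambda>k. Q (fst (snd (u k)))) \<longlonglongrightarrow> Q (fst (snd u'))"
    using tendsto_fst[OF tendsto_snd[OF lim]] by simp
  have z: "(\<lambda>k. fst (snd (snd (u k)))) \<longlonglongrightarrow> fst (snd (snd u'))"
    using tendsto_fst[OF tendsto_snd[OF tendsto_snd[OF lim]]] by simp
  have x: "(\<lambda>k. snd (snd (snd (u k)))) \<longlonglongrightarrow> snd (snd (snd u'))"
    using tendsto_snd[OF tendsto_snd[OF tendsto_snd[OF lim]]] by simp
  note e = tendsto_fst[OF assms(3)] tendsto_fst[OF tendsto_snd[OF assms(3)]]
    tendsto_fst[OF tendsto_snd[OF tendsto_snd[OF assms(3)]]]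
    tendsto_snd[OF tendsto_snd[OF tendsto_snd[OF assms(3)]]]
  note K = assms(1)[unfolded kkt_op_proj]
  show ?thesis unfolding kkt_op_proj
  proof (intro conjI)
    show "- fst u' \<in> subdiff (ind_fun K) (A (snd (snd (snd u'))) - fst e')"
      by (rule subdiff_closed_graph[OF ind_K(2,1), of "\<lambda>k. - fst (u k)" "\<lambda>k. A (snd (snd (snd (u k)))) - fst (e k)"])
         (use K in \<open>auto intro!: tendsto_intros y e tendsto_linear[OF A_lin] x\<close>)
    show "- fst (snd (snd u')) \<in> subdiff \<phi> (snd (snd (snd u')) - fst (snd (snd e')))"
      by (rule subdiff_closed_graph[OF phi(2,1), of "\<lambda>k. - fst (snd (snd (u k)))"
            "\<lambda>k. snd (snd (snd (u k))) - fst (snd (snd (e k)))"])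
         (use K in \<open>auto intro!: tendsto_intros z x e\<close>)
    have "(\<lambda>k. fst (snd (e k))) \<longlonglongrightarrow> Q (fst (snd u')) - Q (snd (snd (snd u')))"
      using K by (auto intro!: tendsto_intros w tendsto_linear[OF Q_lin] x)
    then show "fst (snd e') = Q (fst (snd u')) - Q (snd (snd (snd u')))"
      using e(2) LIMSEQ_unique by blast
    have "(\<lambda>k. snd (snd (snd (e k)))) \<longlonglongrightarrow> Q (fst (snd u')) - B (fst u') - fst (snd (snd u')) + c"
      using K by (auto intro!: tendsto_intros w z tendsto_linear[OF B_lin] y)
    then show "snd (snd (snd e')) = Q (fst (snd u')) - B (fst u') - fst (snd (snd u')) + c"
      using e(4) LIMSEQ_unique by blast
  qed
qed

text \<open>
  For two zeros the three nonnegative products in the proof of monotonicity add up to \<open>0\<close>.  Hence each of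
  them vanishes, and the graphs of both subdifferentials contain the segment.
\<close>

lemma kkt_zeros_convex: "convex {p. kkt_op p 0}"
proof (rule convexI)
  fix p p' :: "('m, 'n) state" and s t :: real
  assume P: "p \<in> {p. kkt_op p 0}" "p' \<in> {p. kkt_op p 0}" and t: "0 \<le> s" "0 \<le> t" "s + t = 1"
  have s: "s = 1 - t" using t by simp
  obtain y w z x y' w' z' x' where p: "p = (y, w, z, x)" "p' = (y', w', z', x')" by (metis prod_cases4)
  have a: "- y \<in> subdiff (ind_fun K) (A x)" "Q w = Q x" "- z \<in> subdiff \<phi> x" "Q w - B y - z + c = 0"
    using P(1) by (auto simp: p kkt_op_def zero_prod_def)
  have b: "- y' \<in> subdiff (ind_fun K) (A x')" "Q w' = Q x'" "- z' \<in> subdiff \<phi> x'" "Q w' - B y' - z' + c = 0"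
    using P(2) by (auto simp: p kkt_op_def zero_prod_def)
  define dy dw dz dx where d: "dy = y - y'" "dw = w - w'" "dz = z - z'" "dx = x - x'"
  have m1: "0 \<le> (- y - - y') \<bullet> (A x - A x')" using subdiff_monotone[OF a(1) b(1)] .
  have m2: "0 \<le> (- z - - z') \<bullet> (x - x')" using subdiff_monotone[OF a(3) b(3)] .
  have "Q w = B y + z - c" "Q w' = B y' + z' - c"
    using a(4) b(4) by (simp_all add: algebra_simps)
  then have r: "B dy + dz = Q dw" by (simp add: d lin_simps)
  have r': "Q dw = Q dx" using a(2) b(2) by (simp add: d lin_simps)
  have "(- y - - y') \<bullet> (A x - A x') + (- z - - z') \<bullet> (x - x') = - (dy \<bullet> A dx) - dz \<bullet> dx"
    by (simp add: d lin_simps algebra_simps)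
  also have "\<dots> = - ((B dy + dz) \<bullet> dx)" by (simp add: inner_A inner_simps)
  also have "\<dots> = - (dw \<bullet> Q dw)" unfolding r using inner_Q[of dw dx] r' by simp
  also have "\<dots> \<le> 0" using Q_psd by (simp add: pos_semidef_def)
  finally have o: "(- y - - y') \<bullet> (A x - A x') = 0" "(- z - - z') \<bullet> (x - x') = 0" using m1 m2 by linarith+
  have "- (s *\<^sub>R y + t *\<^sub>R y') \<in> subdiff (ind_fun K) (A (s *\<^sub>R x + t *\<^sub>R x'))"
    using subdiff_segment[OF ind_K(3) a(1) b(1) o(1), of t] t by (simp add: s lin_simps)
  moreover have "- (s *\<^sub>R z + t *\<^sub>R z') \<in> subdiff \<phi> (s *\<^sub>R x + t *\<^sub>R x')"
    using subdiff_segment[OF phi(3) a(3) b(3) o(2), of t] t by (simp add: s)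
  moreover have "Q (s *\<^sub>R w + t *\<^sub>R w') - Q (s *\<^sub>R x + t *\<^sub>R x') = 0"
    using a(2) b(2) by (simp add: lin_simps)
  moreover have "Q (s *\<^sub>R w + t *\<^sub>R w') - B (s *\<^sub>R y + t *\<^sub>R y') - (s *\<^sub>R z + t *\<^sub>R z') + c = 0"
  proof -
    have "s *\<^sub>R (Q w - B y - z + c) + t *\<^sub>R (Q w' - B y' - z' + c) = 0" unfolding a(4) b(4) by simp
    moreover have "s *\<^sub>R c + t *\<^sub>R c = c" using t by (metis scaleR_left_distrib scaleR_one)
    moreover have "Q (s *\<^sub>R w + t *\<^sub>R w') - B (s *\<^sub>R y + t *\<^sub>R y') - (s *\<^sub>R z + t *\<^sub>R z') + (s *\<^sub>R c + t *\<^sub>R c)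
        = s *\<^sub>R (Q w - B y - z + c) + t *\<^sub>R (Q w' - B y' - z' + c)"
      by (simp add: lin_simps algebra_simps)
    ultimately show ?thesis by simp
  qed
  ultimately show "s *\<^sub>R p + t *\<^sub>R p' \<in> {p. kkt_op p 0}"
    by (simp add: p kkt_op_def zero_prod_def)
qed

text \<open>
  With \<open>d = u - p\<close> and \<open>(my, mw, 0, mx) = prec d\<close>, the definitions of \<open>mx\<close> and \<open>ex\<close> combine to
  \<open>dx = \<sigma> (dz + mx + ex)\<close>, while monotonicity of the subdifferential of \<open>\<phi>\<close> gives \<open>dz \<bullet> dx \<le> 0\<close>.  So \<open>dz\<close>
  and \<open>dx\<close> are small, then \<open>Q dw\<close> by the second and \<open>B dy\<close> by the fourth KKT equation, and finally \<open>Sy dy\<close> by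
  the first component of \<open>prec d\<close>.  Positive definiteness of \<open>Sy + A B\<close> bounds \<open>dy\<close>.  The argument needs
  \<open>ez = 0\<close>, which the range of the preconditioner guarantees.
\<close>

lemma kkt_error_bound:
  obtains C where "C > 0" "\<And>u e p. \<lbrakk>kkt_op u e; fst (snd (snd e)) = 0; kkt_op p 0\<rbrakk>
     \<Longrightarrow> norm (apply_Q Q (u - p)) \<le> C * (norm (prec (u - p)) + norm e)"
proof -
  obtain q where q: "q > 0" "\<And>v. norm (Q v) \<le> q * norm v" using linear_bounded_pos[OF Q_lin] by blast
  obtain a where a: "a > 0" "\<And>v. norm (A v) \<le> a * norm v" using linear_bounded_pos[OF A_lin] by blast
  let ?G = "\<lambda>y. Sy y + A (B y)"
  have G: "linear ?G" using linear_compose_add[OF Sy_lin linear_compose[OF B_lin A_lin]] by (simp add: o_def)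
  moreover have "inj ?G"
    using nondegenerate unfolding linear_injective_0[OF G] pos_def_def by (metis inner_zero_right less_irrefl)
  ultimately obtain g where g: "g > 0" "\<And>y. g * norm y \<le> norm (?G y)"
    using linear_inj_bounded_below_pos by blast
  define c3 where "c3 = q * (2 * \<sigma>) + 1"
  define c4 where "c4 = 1 + a * \<sigma> + \<tau> * a * q * (c3 + 2) + \<sigma> * a * (c3 + 2)"
  define C where "C = c4 / (\<sigma> * g) + c3 + 1 + 2 * \<sigma>"
  have tau: "\<tau> > 0" using sigma_pos denom_pos by simp
  have pos: "c3 > 0" "c4 > 0" "C > 0"
  proof -
    show c3: "c3 > 0" using q(1) sigma_pos by (simp add: c3_def add_pos_pos)
    show c4: "c4 > 0" unfolding c4_def using a(1) q(1) sigma_pos tau c3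
      by (intro add_pos_pos mult_pos_pos) auto
    show "C > 0" unfolding C_def using c3 c4 g(1) sigma_pos by (intro add_pos_pos divide_pos_pos mult_pos_pos) auto
  qed
  show thesis
  proof (rule that[OF \<open>C > 0\<close>])
    fix u e p assume U: "kkt_op u e" "fst (snd (snd e)) = 0" "kkt_op p 0"
    obtain y w z x where u: "u = (y, w, z, x)" by (metis prod_cases4)
    obtain y' w' z' x' where p: "p = (y', w', z', x')" by (metis prod_cases4)
    obtain ey ew ex where e: "e = (ey, ew, 0, ex)" using U(2) by (cases e) auto
    have h: "ew = Q w - Q x" "- z \<in> subdiff \<phi> x" "ex = Q w - B y - z + c"
      using U(1) by (auto simp: u e kkt_op_def)
    have h': "Q w' = Q x'" "- z' \<in> subdiff \<phi> x'" "Q w' - B y' - z' + c = 0"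
      using U(3) by (auto simp: p kkt_op_def zero_prod_def)
    define dy dw dz dx where d: "dy = y - y'" "dw = w - w'" "dz = z - z'" "dx = x - x'"
    obtain my mw mx where m: "prec (u - p) = (my, mw, 0, mx)"
      and my: "my = A dx - \<sigma> *\<^sub>R A (Q dw) + \<sigma> *\<^sub>R A (B dy) + \<tau> *\<^sub>R A (Q (B dy)) + \<sigma> *\<^sub>R Sy dy"
      and mx: "mx = (1 / \<sigma>) *\<^sub>R dx - Q dw + B dy"
      by (simp add: u p d prec_def precQ_def apply_Q_def)
    define N where "N = norm (prec (u - p)) + norm e"
    have "norm my \<le> norm (prec (u - p))" "norm mx \<le> norm (prec (u - p))"
      unfolding m by (meson norm_fst_le norm_snd_le order_trans)+
    moreover have "norm ew \<le> norm e" "norm ex \<le> norm e"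
      unfolding e by (meson norm_fst_le norm_snd_le order_trans)+
    ultimately have N: "norm my \<le> N" "norm mx \<le> N" "norm ew \<le> N" "norm ex \<le> N" "norm mx + norm ex \<le> N"
      unfolding N_def by (smt (verit) norm_ge_zero)+
    have N0: "N \<ge> 0" using N(1) norm_ge_zero order_trans by blast
    have ew: "ew = Q dw - Q dx" using h h' by (simp add: d lin_simps)
    have ex: "ex = Q dw - B dy - dz"
    proof -
      have "ex = (Q w - B y - z + c) - (Q w' - B y' - z' + c)" unfolding h(3) h'(3) by simp
      then show ?thesis by (simp add: d lin_simps)
    qed
    have dx: "dx = \<sigma> *\<^sub>R (dz + (mx + ex))"
      using sigma_pos unfolding mx ex by (simp add: algebra_simps)
    have ndz: "norm dz \<le> N"
    proof -
      have "0 \<le> (- z - - z') \<bullet> (x - x')" using subdiff_monotone[OF h(2) h'(2)] .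
      then have "dz \<bullet> dx \<le> 0" by (simp add: d algebra_simps)
      then have "\<sigma> * (dz \<bullet> (dz + (mx + ex))) \<le> 0" unfolding dx by simp
      then have "dz \<bullet> (dz + (mx + ex)) \<le> 0" using sigma_pos by (simp add: mult_le_0_iff)
      then have "dz \<bullet> dz \<le> - (dz \<bullet> (mx + ex))" unfolding inner_add_right[of dz dz] by linarith
      also have "\<dots> \<le> norm dz * norm (mx + ex)"
        using Cauchy_Schwarz_ineq2[of dz "mx + ex"] by linarith
      finally have "norm dz * norm dz \<le> norm dz * norm (mx + ex)"
        by (simp add: power2_norm_eq_inner[symmetric] power2_eq_square)
      then have "norm dz \<le> norm (mx + ex)" by (cases "dz = 0") auto
      then show ?thesis using norm_triangle_ineq[of mx ex] N(5) by linarith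
    qed
    have ndx: "norm dx \<le> 2 * \<sigma> * N"
    proof -
      have "norm (dz + (mx + ex)) \<le> N + N"
        using norm_triangle_ineq[of dz "mx + ex"] norm_triangle_ineq[of mx ex] N(5) ndz by linarith
      then have "\<sigma> * norm (dz + (mx + ex)) \<le> \<sigma> * (N + N)" using sigma_pos by (intro mult_left_mono) auto
      then show ?thesis unfolding dx using sigma_pos by simp
    qed
    have nQ: "norm (Q dw) \<le> c3 * N"
    proof -
      have "norm (Q dw) \<le> norm ew + norm (Q dx)" using norm_triangle_ineq[of ew "Q dx"] unfolding ew by simp
      also have "\<dots> \<le> N + q * (2 * \<sigma> * N)"
        using N(3) q(2)[of dx] ndx mult_left_mono[OF ndx, of q] q(1) by linarith
      finally show ?thesis by (simp add: c3_def algebra_simps)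
    qed
    have nB: "norm (B dy) \<le> (c3 + 2) * N"
    proof -
      have "B dy = Q dw - dz - ex" unfolding ex by simp
      then have "norm (B dy) \<le> norm (Q dw) + norm dz + norm ex"
        using norm_triangle_ineq4[of "Q dw - dz" ex] norm_triangle_ineq4[of "Q dw" dz] by simp
      then show ?thesis using nQ ndz N(4) by (simp add: algebra_simps)
    qed
    have ndy: "norm dy \<le> c4 / (\<sigma> * g) * N"
    proof -
      have "my = \<sigma> *\<^sub>R A mx + \<tau> *\<^sub>R A (Q (B dy)) + \<sigma> *\<^sub>R Sy dy"
        using sigma_pos unfolding my mx by (simp add: lin_simps algebra_simps)
      then have eq: "\<sigma> *\<^sub>R ?G dy = my - \<sigma> *\<^sub>R A mx - \<tau> *\<^sub>R A (Q (B dy)) + \<sigma> *\<^sub>R A (B dy)"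
        by (simp add: algebra_simps)
      have 1: "norm (A mx) \<le> a * N" using a(2)[of mx] mult_left_mono[OF N(2), of a] a(1) by linarith
      have 2: "norm (A (B dy)) \<le> a * ((c3 + 2) * N)"
        using a(2)[of "B dy"] mult_left_mono[OF nB, of a] a(1) by linarith
      have "norm (Q (B dy)) \<le> q * ((c3 + 2) * N)"
        using q(2)[of "B dy"] mult_left_mono[OF nB, of q] q(1) by linarith
      then have 3: "norm (A (Q (B dy))) \<le> a * (q * ((c3 + 2) * N))"
        using a(2)[of "Q (B dy)"] mult_left_mono[of _ _ a] a(1) by (meson less_imp_le order_trans)
      have "\<sigma> * norm (?G dy) = norm (my - \<sigma> *\<^sub>R A mx - \<tau> *\<^sub>R A (Q (B dy)) + \<sigma> *\<^sub>R A (B dy))"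
        unfolding eq[symmetric] using sigma_pos by simp
      also have "\<dots> \<le> norm my + norm (\<sigma> *\<^sub>R A mx) + norm (\<tau> *\<^sub>R A (Q (B dy))) + norm (\<sigma> *\<^sub>R A (B dy))"
        by (intro order_trans[OF norm_triangle_ineq] order_trans[OF norm_triangle_ineq4] add_mono order_refl)
      also have "\<dots> = norm my + \<sigma> * norm (A mx) + \<tau> * norm (A (Q (B dy))) + \<sigma> * norm (A (B dy))"
        using sigma_pos tau denom_pos by simp
      also have "\<dots> \<le> N + \<sigma> * (a * N) + \<tau> * (a * (q * ((c3 + 2) * N))) + \<sigma> * (a * ((c3 + 2) * N))"
        using sigma_pos tau 1 2 3 N(1) by (intro add_mono mult_left_mono) auto
      also have "\<dots> = c4 * N" by (simp add: c4_def add_divide_distrib algebra_simps)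
      finally have "\<sigma> * norm (?G dy) \<le> c4 * N" .
      moreover have "\<sigma> * (g * norm dy) \<le> \<sigma> * norm (?G dy)" using g(2) sigma_pos by (intro mult_left_mono) auto
      ultimately have "\<sigma> * (g * norm dy) \<le> c4 * N" by linarith
      then show ?thesis using sigma_pos g(1) by (simp add: field_simps)
    qed
    have "apply_Q Q (u - p) = (dy, Q dw, dz, dx)" by (simp add: u p d apply_Q_def)
    then have "norm (apply_Q Q (u - p)) \<le> norm dy + (norm (Q dw) + (norm dz + norm dx))"
      using norm_Pair_le[of dy "(Q dw, dz, dx)"] norm_Pair_le[of "Q dw" "(dz, dx)"] norm_Pair_le[of dz dx]
      by simp
    also have "\<dots> \<le> c4 / (\<sigma> * g) * N + (c3 * N + (N + 2 * \<sigma> * N))"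
      using ndy nQ ndz ndx by (intro add_mono)
    also have "\<dots> = C * N" by (simp add: C_def algebra_simps)
    finally show "norm (apply_Q Q (u - p)) \<le> C * (norm (prec (u - p)) + norm e)" by (simp add: N_def)
  qed
qed

section \<open>Convergence of the Halpern iteration\<close>

text \<open>
  The restriction to \<open>w \<in> range Q\<close> is the one in the dual problem; it also singles out one \<open>w\<close> for each value of \<open>Q w\<close>.
\<close>

definition kkt_zeros :: "('m, 'n) state set" where
  "kkt_zeros = {p. kkt_op p 0 \<and> fst (snd p) \<in> range Q}"

lemma Q_inj_on_range:
  assumes "w \<in> range Q" "Q w = 0" shows "w = 0"
proof -
  obtain v where "w = Q v" using assms(1) by blast
  then have "w \<bullet> w = 0" using assms(2) inner_Q[of w v] by simp
  then show ?thesis by simp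
qed

text \<open>
  The range of \<open>Q\<close> meets its kernel only in \<open>0\<close>, so the part of \<open>Q w\<close> orthogonal to \<open>range (Q \<circ> Q)\<close>,
  which \<open>Q\<close> annihilates, must vanish.
\<close>

lemma range_Q_square: "Q w \<in> range (Q \<circ> Q)"
proof -
  have sub: "subspace (range (Q \<circ> Q))"
    using linear_subspace_image[OF linear_compose[OF Q_lin Q_lin] subspace_UNIV] .
  then obtain a b where ab: "Q w = a + b" "a \<in> range (Q \<circ> Q)" "\<And>v. v \<in> range (Q \<circ> Q) \<Longrightarrow> orthogonal b v"
    using orthogonal_subspace_decomp_exists[of "range (Q \<circ> Q)" "Q w"] span_eq_iff[of "range (Q \<circ> Q)"] by metis
  have "orthogonal b (Q (Q b))" using ab(3) by auto
  then have "Q b = 0" using inner_Q[of b "Q b"] by (simp add: orthogonal_def)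
  moreover have "b \<in> range Q"
  proof -
    obtain v where "a = Q (Q v)" using ab(2) by auto
    then have "b = Q (w - Q v)" using ab(1) by (simp add: lin_simps)
    then show ?thesis by blast
  qed
  ultimately have "b = 0" by (rule Q_inj_on_range[rotated])
  with ab show ?thesis by simp
qed

text \<open>
  A sublevel set of the seminorm may be unbounded, but its intersection with the zeros is not: the error bound
  with zero residual controls \<open>(y, Q w, z, x)\<close>, and \<open>w\<close> is controlled by \<open>Q w\<close> because it lies in the range of \<open>Q\<close>.
\<close>

lemma kkt_zeros_attain_min:
  assumes "kkt_zeros \<noteq> {}"
  obtains p where "p \<in> kkt_zeros" "\<And>p'. p' \<in> kkt_zeros \<Longrightarrow> op_norm prec (u0 - p) \<le> op_norm prec (u0 - p')"
proof -
  obtain p1 where p1: "p1 \<in> kkt_zeros" using assms by blast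
  let ?f = "\<lambda>p. op_norm prec (u0 - p)"
  let ?S = "{p \<in> kkt_zeros. ?f p \<le> ?f p1}"
  note sub = linear_subspace_image[OF Q_lin subspace_UNIV]
  have cont_f: "continuous_on UNIV ?f"
    unfolding op_norm_def
    by (intro continuous_intros linear_continuous_on linear_continuous_on_compose[OF _ prec_linear])
  have clos: "closed ?S"
    unfolding closed_sequential_limits
  proof (intro allI impI, elim conjE)
    fix s l assume s: "\<forall>n. s n \<in> ?S" and lim: "s \<longlonglongrightarrow> l"
    have "kkt_op l 0"
    proof (rule kkt_op_closed)
      show "kkt_op (s k) 0" for k using s by (simp add: kkt_zeros_def)
      show "(\<lambda>k. apply_Q Q (s k)) \<longlonglongrightarrow> apply_Q Q l" by (rule tendsto_linear[OF apply_Q_linear lim])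
    qed simp
    moreover have "fst (snd l) \<in> range Q"
    proof (rule closed_sequentially[OF closed_subspace[OF sub]])
      show "fst (snd (s n)) \<in> range Q" for n using s by (simp add: kkt_zeros_def)
      show "(\<lambda>n. fst (snd (s n))) \<longlonglongrightarrow> fst (snd l)" by (intro tendsto_intros lim)
    qed
    moreover have "?f l \<le> ?f p1"
    proof (rule LIMSEQ_le_const2)
      show "(\<lambda>n. ?f (s n)) \<longlonglongrightarrow> ?f l"
        by (rule continuous_on_tendsto_compose[OF cont_f lim]) auto
      show "\<exists>N. \<forall>n\<ge>N. ?f (s n) \<le> ?f p1" using s by auto
    qed
    ultimately show "l \<in> ?S" by (simp add: kkt_zeros_def)
  qed
  have bdd: "bounded ?S"
  proof -
    obtain C where C: "C > 0" "\<And>u e p. \<lbrakk>kkt_op u e; fst (snd (snd e)) = 0; kkt_op p 0\<rbrakk>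
       \<Longrightarrow> norm (apply_Q Q (u - p)) \<le> C * (norm (prec (u - p)) + norm e)" using kkt_error_bound by blast
    obtain D where D: "D > 0" "\<And>a. norm (prec a) \<le> D * op_norm prec a"
      using norm_le_op_norm[OF prec_self_adjoint prec_psd] by blast
    obtain r where r: "r > 0" "\<And>w. w \<in> range Q \<Longrightarrow> r * norm w \<le> norm (Q w)"
    proof -
      have "\<forall>w\<in>range Q. Q w = 0 \<longrightarrow> w = 0"
        using Q_inj_on_range by blast
      from injective_imp_isometric[OF closed_subspace[OF sub] sub _ this]
      obtain r where "r > 0" "\<forall>w\<in>range Q. norm (Q w) \<ge> r * norm w"
        using Q_lin linear_conv_bounded_linear by blast
      then show thesis using that by blast
    qed
    let ?R = "C * (D * (2 * ?f p1))"
    have "norm (p - p1) \<le> ?R + ?R / r + ?R + ?R" if p: "p \<in> ?S" for p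
    proof -
      have "op_norm prec (u0 - p1 + (- 1) *\<^sub>R (u0 - p)) \<le> ?f p1 + ?f p"
        using op_norm_triangle[OF prec_self_adjoint prec_psd, of "u0 - p1" "(- 1) *\<^sub>R (u0 - p)"]
        by (simp only: op_norm_scaleR[OF prec_linear])
      then have "op_norm prec (p - p1) \<le> 2 * ?f p1" using p by simp
      then have "norm (prec (p - p1)) \<le> D * (2 * ?f p1)"
        using D by (meson less_imp_le mult_left_mono order_trans)
      moreover have "norm (apply_Q Q (p - p1)) \<le> C * (norm (prec (p - p1)) + norm (0::('m,'n) state))"
        by (rule C(2)) (use p p1 in \<open>auto simp: kkt_zeros_def\<close>)
      ultimately have R: "norm (apply_Q Q (p - p1)) \<le> ?R"
        using C(1) by (smt (verit) mult_left_mono norm_zero)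
      obtain y w z x where d: "p - p1 = (y, w, z, x)" by (metis prod_cases4)
      have "w \<in> range Q"
      proof -
        have "w = fst (snd p) - fst (snd p1)" using d by (metis fst_conv fst_diff snd_conv snd_diff)
        then show ?thesis using p p1 sub by (auto simp: kkt_zeros_def intro: subspace_diff)
      qed
      have "norm y \<le> ?R" "norm (Q w) \<le> ?R" "norm z \<le> ?R" "norm x \<le> ?R"
        using R unfolding d apply_Q_def by simp_all (meson norm_fst_le norm_snd_le order_trans)+
      moreover have "norm w \<le> ?R / r"
        using r(2)[OF \<open>w \<in> range Q\<close>] \<open>norm (Q w) \<le> ?R\<close> r(1) by (simp add: field_simps)
      ultimately show ?thesis unfolding d
        using norm_Pair_le[of y "(w, z, x)"] norm_Pair_le[of w "(z, x)"] norm_Pair_le[of z x] by linarith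
    qed
    then have "\<forall>p\<in>?S. dist p1 p \<le> ?R + ?R / r + ?R + ?R" by (simp add: dist_norm norm_minus_commute)
    then show ?thesis unfolding bounded_def by blast
  qed
  have "compact ?S" using clos bdd by (simp add: compact_eq_bounded_closed)
  moreover have "p1 \<in> ?S" using p1 by simp
  then have "?S \<noteq> {}" by (rule ex_in_conv[THEN iffD1, OF exI])
  moreover have "continuous_on ?S ?f" by (rule continuous_on_subset[OF cont_f]) simp
  ultimately have "\<exists>p\<in>?S. \<forall>p'\<in>?S. ?f p \<le> ?f p'"
    by (rule continuous_attains_inf)
  then obtain p where p: "p \<in> ?S" "\<forall>p'\<in>?S. ?f p \<le> ?f p'"
    by (rule bexE)
  show thesis
  proof (rule that)
    show "p \<in> kkt_zeros" using p(1) by simp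
    show "?f p \<le> ?f p'" if "p' \<in> kkt_zeros" for p'
    proof (cases "?f p' \<le> ?f p1")
      case True
      with that have "p' \<in> ?S" by simp
      with p(2) show ?thesis by (rule bspec)
    next
      case False
      with p(1) show ?thesis by simp
    qed
  qed
qed

text \<open>
  The variational inequality of the projection; it uses convexity of the set of zeros.
\<close>

lemma kkt_projection:
  assumes "kkt_zeros \<noteq> {}"
  obtains p where "p \<in> kkt_zeros" "\<And>p'. kkt_op p' 0 \<Longrightarrow> fst (snd p') \<in> range Q \<Longrightarrow> (u0 - p) \<bullet> prec (p' - p) \<le> 0"
proof -
  obtain p where p: "p \<in> kkt_zeros" "\<And>p'. p' \<in> kkt_zeros \<Longrightarrow> op_norm prec (u0 - p) \<le> op_norm prec (u0 - p')"
    using kkt_zeros_attain_min[OF assms] by blast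
  show thesis
  proof (rule that[OF p(1)])
    fix p' assume "kkt_op p' 0" "fst (snd p') \<in> range Q"
    have "0 \<le> - (2 * ((u0 - p) \<bullet> prec (p' - p)))"
    proof (rule first_order_nonneg)
      fix t :: real assume t: "0 < t" "t \<le> 1"
      let ?q = "(1 - t) *\<^sub>R p + t *\<^sub>R p'"
      have "kkt_op ?q 0"
        using convexD_alt[OF kkt_zeros_convex, of p p' t] p(1) \<open>kkt_op p' 0\<close> t by (simp add: kkt_zeros_def)
      moreover have "fst (snd ?q) \<in> range Q"
        using p(1) \<open>fst (snd p') \<in> range Q\<close> linear_subspace_image[OF Q_lin subspace_UNIV]
        by (auto simp: kkt_zeros_def intro!: subspace_add subspace_scale)
      ultimately have "op_norm prec (u0 - p) \<le> op_norm prec (u0 - ?q)"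
        by (intro p(2)) (simp add: kkt_zeros_def)
      then have "(u0 - p) \<bullet> prec (u0 - p) \<le> (u0 - ?q) \<bullet> prec (u0 - ?q)"
        by (simp add: op_norm_def)
      also have "u0 - ?q = (u0 - p) + (- t) *\<^sub>R (p' - p)" by (simp add: algebra_simps)
      finally show "0 \<le> t * - (2 * ((u0 - p) \<bullet> prec (p' - p))) + t\<^sup>2 * ((p' - p) \<bullet> prec (p' - p))"
        unfolding form_sum_scaled[OF prec_self_adjoint] by simp
    qed
    then show "(u0 - p) \<bullet> prec (p' - p) \<le> 0" by simp
  qed
qed

text \<open>
  The limit is the projection \<open>p\<close> of the initial point onto the zeros.  If the inner products
  with \<open>u 0 - p\<close> exceeded some \<open>\<epsilon>\<close> infinitely often, a cluster point of the corresponding resolvent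
  values would be a zero violating the variational inequality of the projection.
\<close>

theorem halpern_resolvents_converge:
  fixes u ub :: "nat \<Rightarrow> ('m, 'n) state"
  assumes ne: "kkt_zeros \<noteq> {}"
    and step: "\<And>k. kkt_op (ub (Suc k)) (prec (u k - ub (Suc k)))"
    and update: "\<And>k. u (Suc k) = halpern_update k (u 0) (u k) (ub (Suc k))"
  obtains p where "p \<in> kkt_zeros" "(\<lambda>k. apply_Q Q (ub k)) \<longlonglongrightarrow> apply_Q Q p"
proof -
  interpret halpern_resolvent prec u ub kkt_zeros
  proof
    show "0 \<le> (ub (Suc j) - ub (Suc k)) \<bullet> prec ((u j - ub (Suc j)) - (u k - ub (Suc k)))" for j k
      unfolding linear_diff[OF prec_linear, of "u j - ub (Suc j)"] by (rule kkt_op_monotone[OF step step])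
    show "0 \<le> (ub (Suc j) - p) \<bullet> prec (u j - ub (Suc j))" if "p \<in> kkt_zeros" for j p
      using kkt_op_monotone[OF step[of j], of p 0] that by (simp add: kkt_zeros_def)
  qed (use prec_self_adjoint prec_psd update ne in auto)
  obtain C where C: "C > 0" "\<And>u e p. \<lbrakk>kkt_op u e; fst (snd (snd e)) = 0; kkt_op p 0\<rbrakk>
     \<Longrightarrow> norm (apply_Q Q (u - p)) \<le> C * (norm (prec (u - p)) + norm e)" using kkt_error_bound by blast
  obtain D where D: "D > 0" "\<And>a. norm (prec a) \<le> D * op_norm prec a"
    using norm_le_op_norm[OF prec_self_adjoint prec_psd] by blast
  obtain p where p: "p \<in> kkt_zeros"
    "\<And>p'. kkt_op p' 0 \<Longrightarrow> fst (snd p') \<in> range Q \<Longrightarrow> (u 0 - p) \<bullet> prec (p' - p) \<le> 0"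
    using kkt_projection[OF ne] by blast
  have z0: "fst (snd (snd (prec v))) = 0" for v
    by (simp add: prec_def precQ_def case_prod_beta)
  have p0: "kkt_op p 0" using p(1) by (simp add: kkt_zeros_def)
  let ?res = "\<lambda>k. prec (u k - ub (Suc k))"
  have bound: "norm (apply_Q Q (ub (Suc k) - p))
      \<le> C * (D * op_norm prec (ub (Suc k) - p) + D * op_norm prec (u k - ub (Suc k)))" for k
  proof -
    have "norm (apply_Q Q (ub (Suc k) - p)) \<le> C * (norm (prec (ub (Suc k) - p)) + norm (?res k))"
      by (rule C(2)[OF step z0 p0])
    also have "\<dots> \<le> C * (D * op_norm prec (ub (Suc k) - p) + D * op_norm prec (u k - ub (Suc k)))"
      using C(1) D(2) by (intro mult_left_mono add_mono) auto
    finally show ?thesis .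
  qed
  have res0: "?res \<longlonglongrightarrow> 0"
  proof (rule Lim_null_comparison)
    show "eventually (\<lambda>k. norm (?res k) \<le> D * op_norm prec (u k - ub (Suc k))) sequentially"
      using D(2) by simp
    show "(\<lambda>k. D * op_norm prec (u k - ub (Suc k))) \<longlonglongrightarrow> 0"
      using tendsto_mult_right_zero[OF residual_tendsto_0] .
  qed
  have bdd: "bounded (range (\<lambda>k. apply_Q Q (ub (Suc k))))"
  proof -
    obtain E where E: "\<And>k. norm (op_norm prec (u k - ub (Suc k))) \<le> E"
      using convergent_imp_Bseq[OF convergentI[OF residual_tendsto_0]] unfolding Bseq_def by blast
    have "norm (apply_Q Q (ub (Suc k))) \<le> C * (D * op_norm prec (u 0 - p) + D * E) + norm (apply_Q Q p)" for k
    proof -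
      have "norm (apply_Q Q (ub (Suc k))) \<le> norm (apply_Q Q (ub (Suc k) - p)) + norm (apply_Q Q p)"
        using norm_triangle_ineq[of "apply_Q Q (ub (Suc k) - p)" "apply_Q Q p"]
        by (simp add: linear_diff[OF apply_Q_linear])
      also have "norm (apply_Q Q (ub (Suc k) - p)) \<le> C * (D * op_norm prec (u 0 - p) + D * E)"
      proof (rule order_trans[OF bound])
        have "op_norm prec (u k - ub (Suc k)) \<le> E" using E[of k] by (simp add: abs_le_iff)
        then show "C * (D * op_norm prec (ub (Suc k) - p) + D * op_norm prec (u k - ub (Suc k)))
          \<le> C * (D * op_norm prec (u 0 - p) + D * E)"
          using C(1) D(1) resolvents_bounded[OF p(1), of k] by (intro mult_left_mono add_mono) auto
      qed
      finally show ?thesis by simp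
    qed
    then show ?thesis unfolding bounded_iff by blast
  qed
  have u_lim: "(\<lambda>k. op_norm prec (u k - p)) \<longlonglongrightarrow> 0"
  proof (rule iterates_tendsto[OF p(1)])
    fix \<epsilon> :: real assume \<epsilon>: "\<epsilon> > 0"
    show "eventually (\<lambda>k. (u 0 - p) \<bullet> prec (u k - p) \<le> \<epsilon>) sequentially"
    proof (rule ccontr)
      assume "\<not> ?thesis"
      then have "infinite {k. \<not> (u 0 - p) \<bullet> prec (u k - p) \<le> \<epsilon>}"
        by (simp add: cofinite_eq_sequentially[symmetric] eventually_cofinite)
      then obtain r :: "nat \<Rightarrow> nat" where r: "strict_mono r" "\<And>k. \<not> (u 0 - p) \<bullet> prec (u (r k) - p) \<le> \<epsilon>"
        using infinite_enumerate[of "{k. \<not> (u 0 - p) \<bullet> prec (u k - p) \<le> \<epsilon>}"] by auto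
      have "bounded (range (\<lambda>k. apply_Q Q (ub (Suc (r k)))))"
        using bdd by (rule bounded_subset) auto
      then obtain l s where s: "strict_mono (s::nat\<Rightarrow>nat)" and l: "((\<lambda>k. apply_Q Q (ub (Suc (r k)))) \<circ> s) \<longlonglongrightarrow> l"
        using bounded_imp_convergent_subsequence by blast
      let ?i = "\<lambda>k. r (s k)"
      have i: "strict_mono ?i" using strict_mono_o[OF r(1) s] by (simp add: o_def)
      have l: "(\<lambda>k. apply_Q Q (ub (Suc (?i k)))) \<longlonglongrightarrow> l" using l by (simp add: o_def)
      have "\<exists>p'. l = apply_Q Q p' \<and> fst (snd p') \<in> range Q"
      proof -
        obtain y v z x where l': "l = (y, v, z, x)" by (metis prod_cases4)
        \<comment> \<open>Choosing \<open>w\<close> inside \<open>range Q\<close> requires \<open>v\<close> to lie in the range of \<open>Q\<^sup>2\<close>.\<close>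
        have "v \<in> (Q \<circ> Q) ` UNIV"
        proof (rule closed_sequentially[OF closed_subspace[OF linear_subspace_image[OF linear_compose[OF Q_lin Q_lin] subspace_UNIV]]])
          have "Q w \<in> (Q \<circ> Q) ` UNIV" for w
            using range_Q_square by simp
          then show "fst (snd (apply_Q Q (ub (Suc (?i k))))) \<in> (Q \<circ> Q) ` UNIV" for k
            by (simp add: apply_Q_def case_prod_beta)
          show "(\<lambda>k. fst (snd (apply_Q Q (ub (Suc (?i k)))))) \<longlonglongrightarrow> v"
            using tendsto_fst[OF tendsto_snd[OF l]] by (simp add: l')
        qed
        then obtain v' where "v = Q (Q v')" by auto
        then show ?thesis by (intro exI[of _ "(y, Q v', z, x)"]) (simp add: l' apply_Q_def)
      qed
      then obtain p' where p': "l = apply_Q Q p'" "fst (snd p') \<in> range Q" by blast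
      have res_i: "(\<lambda>k. ?res (?i k)) \<longlonglongrightarrow> 0"
        using LIMSEQ_subseq_LIMSEQ[OF res0 i] by (simp add: o_def)
      have "kkt_op p' 0"
        by (rule kkt_op_closed[OF step l[unfolded p'] res_i])
      then have neg: "(u 0 - p) \<bullet> prec (p' - p) \<le> 0" using p(2) p'(2) by blast
      have "(\<lambda>k. prec (ub (Suc (?i k)))) \<longlonglongrightarrow> prec p'"
        unfolding prec_def using tendsto_linear[OF precQ_linear l[unfolded p']] .
      then have "(\<lambda>k. (u 0 - p) \<bullet> (?res (?i k) + prec (ub (Suc (?i k))) - prec p)) \<longlonglongrightarrow> (u 0 - p) \<bullet> (0 + prec p' - prec p)"
        by (intro tendsto_intros res_i)
      then have lim: "(\<lambda>k. (u 0 - p) \<bullet> prec (u (?i k) - p)) \<longlonglongrightarrow> (u 0 - p) \<bullet> prec (p' - p)"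
        by (simp add: linear_diff[OF prec_linear])
      have "\<epsilon> \<le> (u 0 - p) \<bullet> prec (p' - p)"
        by (rule LIMSEQ_le_const[OF lim]) (use r(2) in \<open>auto intro: less_imp_le simp: not_le\<close>)
      with neg \<epsilon> show False by simp
    qed
  qed
  have ub_lim: "(\<lambda>k. op_norm prec (ub (Suc k) - p)) \<longlonglongrightarrow> 0"
  proof (rule tendsto_sandwich[OF _ _ tendsto_const u_lim])
    show "eventually (\<lambda>k. op_norm prec (ub (Suc k) - p) \<le> op_norm prec (u k - p)) sequentially"
      using reflect_le_zero(2)[OF p(1)] by simp
  qed (simp add: op_norm_nonneg[OF prec_psd])
  have "(\<lambda>k. apply_Q Q (ub (Suc k) - p)) \<longlonglongrightarrow> 0"
  proof (rule Lim_null_comparison)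
    show "eventually (\<lambda>k. norm (apply_Q Q (ub (Suc k) - p))
      \<le> C * (D * op_norm prec (ub (Suc k) - p) + D * op_norm prec (u k - ub (Suc k)))) sequentially"
      using bound by simp
    have "(\<lambda>k. C * (D * op_norm prec (ub (Suc k) - p) + D * op_norm prec (u k - ub (Suc k)))) \<longlonglongrightarrow> C * (D * 0 + D * 0)"
      by (intro tendsto_intros ub_lim residual_tendsto_0)
    then show "(\<lambda>k. C * (D * op_norm prec (ub (Suc k) - p) + D * op_norm prec (u k - ub (Suc k)))) \<longlonglongrightarrow> 0"
      by simp
  qed
  then have "(\<lambda>k. apply_Q Q (ub (Suc k))) \<longlonglongrightarrow> apply_Q Q p"
    unfolding linear_diff[OF apply_Q_linear] by (simp add: LIM_zero_iff)
  then have "(\<lambda>k. apply_Q Q (ub k)) \<longlonglongrightarrow> apply_Q Q p"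
    by (rule LIMSEQ_imp_Suc)
  with p(1) show thesis by (rule that)
qed

end


section \<open>First-order conditions for the subproblems\<close>

lemma norm_sq_line:
  fixes a b :: "'a::real_inner"
  shows "(norm (a + t *\<^sub>R b))\<^sup>2 = (norm a)\<^sup>2 + t * (2 * (a \<bullet> b)) + t\<^sup>2 * (norm b)\<^sup>2"
  unfolding power2_norm_eq_inner by (simp add: inner_simps inner_commute power2_eq_square algebra_simps)

text \<open>
  Fermat's rule for a conjugate function plus a quadratic \<open>g\<close>.  The reflected argument \<open>- v\<close> is the
  one in which the augmented Lagrangian contains the conjugates, and it makes the gradient \<open>s\<close> of \<open>g\<close>,
  rather than \<open>- s\<close>, a subgradient.
\<close>

lemma arg_min_conjugate_subgradient:
  assumes pr: "proper_fun f" and fin: "conjugate f (- v0) \<noteq> \<infinity>"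
    and min: "is_arg_min (\<lambda>v. conjugate f (- v) + ereal (g v)) (\<lambda>_. True) vb"
    and line: "\<And>d t. g (vb + t *\<^sub>R d) = g vb + t * (s \<bullet> d) + t\<^sup>2 * q d"
  shows "s \<in> subdiff (conjugate f) (- vb)"
proof -
  have le: "conjugate f (- vb) + ereal (g vb) \<le> conjugate f (- v) + ereal (g v)" for v
    using min by (simp add: is_arg_min_def not_less)
  obtain r where r: "conjugate f (- vb) = ereal r"
    using le[of v0] fin conjugate_not_MInf[OF pr] by (cases "conjugate f (- vb)"; cases "conjugate f (- v0)") auto
  have "ereal (r + s \<bullet> (v' - (- vb))) \<le> conjugate f v'" for v'
  proof (cases "conjugate f v'")
    case (real r')
    let ?d = "- v' - vb"
    have "0 \<le> (r' - r) + s \<bullet> ?d"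
    proof (rule first_order_nonneg)
      fix t :: real assume t: "0 < t" "t \<le> 1"
      have "conjugate f (- vb + t *\<^sub>R (v' - (- vb))) \<le> ereal (r + t * (r' - r))"
        using r real t by (intro conjugate_convex[OF pr]) auto
      also have "- vb + t *\<^sub>R (v' - (- vb)) = - (vb + t *\<^sub>R ?d)" by (simp add: algebra_simps)
      finally have "conjugate f (- (vb + t *\<^sub>R ?d)) \<le> ereal (r + t * (r' - r))" .
      with le[of "vb + t *\<^sub>R ?d"] have "r + g vb \<le> r + t * (r' - r) + g (vb + t *\<^sub>R ?d)"
        unfolding r by (cases "conjugate f (- (vb + t *\<^sub>R ?d))") auto
      then show "0 \<le> t * ((r' - r) + s \<bullet> ?d) + t\<^sup>2 * q ?d"
        unfolding line by (simp add: algebra_simps)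
    qed
    then show ?thesis using real by (simp add: inner_simps)
  next
    case MInf
    with conjugate_not_MInf[OF pr, of v'] show ?thesis by simp
  qed auto
  then show ?thesis unfolding subdiff_iff using r by blast
qed

text \<open>
  Minimality makes the gradient orthogonal to the subspace; as it also lies in the subspace, it is \<open>0\<close>.
\<close>

lemma arg_min_subspace_gradient:
  fixes g :: "'a::euclidean_space \<Rightarrow> real"
  assumes S: "subspace S" and min: "is_arg_min (\<lambda>v. ereal (g v)) (\<lambda>v. v \<in> S) vb"
    and line: "\<And>d t. g (vb + t *\<^sub>R d) = g vb + t * (s \<bullet> d) + t\<^sup>2 * q d"
    and s: "s \<in> S"
  shows "s = 0"
proof -
  have "0 \<le> s \<bullet> (- s)"
  proof (rule first_order_nonneg)
    fix t :: real
    have "vb + t *\<^sub>R (- s) \<in> S"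
      using min S s unfolding is_arg_min_def
      by (metis subspace_add subspace_neg subspace_scale)
    then have "g vb \<le> g (vb + t *\<^sub>R (- s))" using min by (auto simp: is_arg_min_def not_less)
    then show "0 \<le> t * (s \<bullet> (- s)) + t\<^sup>2 * q (- s)" unfolding line by simp
  qed
  then have "s \<bullet> s = 0" using inner_ge_zero[of s] by simp
  then show ?thesis by simp
qed

context composite_qp
begin

section \<open>Both algorithms take resolvent steps\<close>

abbreviation resid :: "real^'m \<Rightarrow> real^'n \<Rightarrow> real^'n \<Rightarrow> real^'n" where
  "resid y v z \<equiv> - v + B y + z - c"

text \<open>
  The optimality conditions of one sweep, with the equations for \<open>wh\<close> and \<open>wb\<close> weakened to their images
  under \<open>Q\<close>, which is the form that both algorithms share.
\<close>

definition opt_step :: "('m, 'n) state \<Rightarrow> ('m, 'n) state \<Rightarrow> bool" where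
  "opt_step u ub \<longleftrightarrow> (\<exists>y w z x yb wb zb xb wh.
     u = (y, w, z, x) \<and> ub = (yb, wb, zb, xb) \<and>
     xb = x + \<sigma> *\<^sub>R resid y (Q w) zb \<and>
     - zb \<in> subdiff \<phi> xb \<and>
     denom *\<^sub>R Q wh = Q ((\<sigma> * lamQ) *\<^sub>R w + xb + \<sigma> *\<^sub>R resid y (Q w) zb) \<and>
     - yb \<in> subdiff (ind_fun K) (A (xb + \<sigma> *\<^sub>R resid yb (Q wh) zb) + \<sigma> *\<^sub>R Sy (yb - y)) \<and>
     denom *\<^sub>R Q wb = Q ((\<sigma> * lamQ) *\<^sub>R w + xb + \<sigma> *\<^sub>R resid yb (Q w) zb))"

text \<open>
  Subtracting the two equations for \<open>w\<close> gives \<open>denom (Q wb - Q wh) = \<sigma> Q B dy\<close>.  Replacing \<open>Q wh\<close> by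
  \<open>Q wb\<close> in the inclusion for \<open>yb\<close> therefore costs the term \<open>\<tau> A Q B dy\<close>, which is why it
  appears in the preconditioner.
\<close>

lemma opt_step_kkt_op:
  assumes "opt_step u ub" shows "kkt_op ub (prec (u - ub))"
proof -
  obtain y w z x yb wb zb xb wh where u: "u = (y, w, z, x)" "ub = (yb, wb, zb, xb)"
    and xb: "xb = x + \<sigma> *\<^sub>R resid y (Q w) zb"
    and z: "- zb \<in> subdiff \<phi> xb"
    and wh: "denom *\<^sub>R Q wh = Q ((\<sigma> * lamQ) *\<^sub>R w + xb + \<sigma> *\<^sub>R resid y (Q w) zb)"
    and yb: "- yb \<in> subdiff (ind_fun K) (A (xb + \<sigma> *\<^sub>R resid yb (Q wh) zb) + \<sigma> *\<^sub>R Sy (yb - y))"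
    and wb: "denom *\<^sub>R Q wb = Q ((\<sigma> * lamQ) *\<^sub>R w + xb + \<sigma> *\<^sub>R resid yb (Q w) zb)"
    using assms unfolding opt_step_def by blast
  define dy dw dx where d: "dy = yb - y" "dw = wb - w" "dx = xb - x"
  have r: "\<sigma> *\<^sub>R resid yb (Q wb) zb = dx - \<sigma> *\<^sub>R Q dw + \<sigma> *\<^sub>R B dy"
    unfolding d xb by (simp add: lin_simps algebra_simps)
  have "denom *\<^sub>R (Q wb - Q wh) = \<sigma> *\<^sub>R Q (B dy)"
    unfolding scaleR_diff_right wb wh by (simp add: d lin_simps algebra_simps)
  then have "(\<sigma> / denom) *\<^sub>R (denom *\<^sub>R (Q wb - Q wh)) = (\<sigma> / denom) *\<^sub>R (\<sigma> *\<^sub>R Q (B dy))" by simp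
  then have "\<sigma> *\<^sub>R (Q wb - Q wh) = \<tau> *\<^sub>R Q (B dy)"
    using denom_pos by (simp add: power2_eq_square)
  then have rh: "\<sigma> *\<^sub>R resid yb (Q wh) zb = dx - \<sigma> *\<^sub>R Q dw + \<sigma> *\<^sub>R B dy + \<tau> *\<^sub>R Q (B dy)"
    using r by (simp add: algebra_simps)
  have "prec (u - ub) = - prec (ub - u)"
    by (metis linear_neg[OF prec_linear] minus_diff_eq)
  also have "prec (ub - u) =
     (A dx - \<sigma> *\<^sub>R A (Q dw) + \<sigma> *\<^sub>R A (B dy) + \<tau> *\<^sub>R A (Q (B dy)) + \<sigma> *\<^sub>R Sy dy,
      (\<sigma> * lamQ) *\<^sub>R Q dw - Q dx - \<sigma> *\<^sub>R Q (B dy), 0, (1 / \<sigma>) *\<^sub>R dx - Q dw + B dy)"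
    by (simp add: u d prec_def precQ_def apply_Q_def)
  finally have p: "prec (u - ub) =
     (- (A dx - \<sigma> *\<^sub>R A (Q dw) + \<sigma> *\<^sub>R A (B dy) + \<tau> *\<^sub>R A (Q (B dy)) + \<sigma> *\<^sub>R Sy dy),
      - ((\<sigma> * lamQ) *\<^sub>R Q dw - Q dx - \<sigma> *\<^sub>R Q (B dy)), 0, - ((1 / \<sigma>) *\<^sub>R dx - Q dw + B dy))"
    by simp
  have 1: "A (xb + \<sigma> *\<^sub>R resid yb (Q wh) zb) + \<sigma> *\<^sub>R Sy (yb - y)
     = A xb - - (A dx - \<sigma> *\<^sub>R A (Q dw) + \<sigma> *\<^sub>R A (B dy) + \<tau> *\<^sub>R A (Q (B dy)) + \<sigma> *\<^sub>R Sy dy)"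
    unfolding rh d(1)[symmetric] by (simp add: lin_simps)
  have 2: "- ((\<sigma> * lamQ) *\<^sub>R Q dw - Q dx - \<sigma> *\<^sub>R Q (B dy)) = Q wb - Q xb"
  proof -
    have "\<sigma> *\<^sub>R resid yb (Q w) zb = dx + \<sigma> *\<^sub>R B dy"
      unfolding d xb by (simp add: lin_simps algebra_simps)
    then have "denom *\<^sub>R Q wb = (\<sigma> * lamQ) *\<^sub>R Q w + Q xb + Q dx + \<sigma> *\<^sub>R Q (B dy)"
      unfolding wb by (simp add: lin_simps)
    then have "Q wb = (\<sigma> * lamQ) *\<^sub>R Q w + Q xb + Q dx + \<sigma> *\<^sub>R Q (B dy) - (\<sigma> * lamQ) *\<^sub>R Q wb"
      by (simp add: algebra_simps)
    then show ?thesis by (simp add: d lin_simps algebra_simps)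
  qed
  have 3: "- ((1 / \<sigma>) *\<^sub>R dx - Q dw + B dy) = Q wb - B yb - zb + c"
  proof -
    have "(1 / \<sigma>) *\<^sub>R dx = resid y (Q w) zb" unfolding d xb using sigma_pos by simp
    then show ?thesis by (simp add: d lin_simps algebra_simps)
  qed
  show ?thesis
    unfolding p unfolding u kkt_op_def
    using yb[unfolded 1] 2 3 z by simp
qed

text \<open>
  The inclusions for \<open>zb\<close> and \<open>yb\<close> are strongly monotone, the latter by positive definiteness
  of \<open>Sy + A B\<close>; the remaining components are explicit.
\<close>

lemma opt_step_unique:
  assumes "opt_step u1 ub1" "opt_step u2 ub2" "apply_Q Q u1 = apply_Q Q u2"
  shows "apply_Q Q ub1 = apply_Q Q ub2"
proof -
  obtain y w z x yb wb zb xb wh where u: "u1 = (y, w, z, x)" "ub1 = (yb, wb, zb, xb)"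
    and a: "xb = x + \<sigma> *\<^sub>R resid y (Q w) zb"
     "- zb \<in> subdiff \<phi> xb"
     "denom *\<^sub>R Q wh = Q ((\<sigma> * lamQ) *\<^sub>R w + xb + \<sigma> *\<^sub>R resid y (Q w) zb)"
     "- yb \<in> subdiff (ind_fun K) (A (xb + \<sigma> *\<^sub>R resid yb (Q wh) zb) + \<sigma> *\<^sub>R Sy (yb - y))"
     "denom *\<^sub>R Q wb = Q ((\<sigma> * lamQ) *\<^sub>R w + xb + \<sigma> *\<^sub>R resid yb (Q w) zb)"
    using assms(1) unfolding opt_step_def by blast
  obtain y' w' z' x' yb' wb' zb' xb' wh' where u': "u2 = (y', w', z', x')" "ub2 = (yb', wb', zb', xb')"
    and b: "xb' = x' + \<sigma> *\<^sub>R resid y' (Q w') zb'"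
     "- zb' \<in> subdiff \<phi> xb'"
     "denom *\<^sub>R Q wh' = Q ((\<sigma> * lamQ) *\<^sub>R w' + xb' + \<sigma> *\<^sub>R resid y' (Q w') zb')"
     "- yb' \<in> subdiff (ind_fun K) (A (xb' + \<sigma> *\<^sub>R resid yb' (Q wh') zb') + \<sigma> *\<^sub>R Sy (yb' - y'))"
     "denom *\<^sub>R Q wb' = Q ((\<sigma> * lamQ) *\<^sub>R w' + xb' + \<sigma> *\<^sub>R resid yb' (Q w') zb')"
    using assms(2) unfolding opt_step_def by blast
  have e: "y' = y" "Q w' = Q w" "x' = x" using assms(3) by (auto simp: u u' apply_Q_def)
  have "zb = zb'"
  proof -
    have "0 \<le> (- zb - - zb') \<bullet> (xb - xb')" using subdiff_monotone[OF a(2) b(2)] .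
    also have "xb - xb' = \<sigma> *\<^sub>R (zb - zb')" unfolding a(1) b(1) e by (simp add: algebra_simps)
    finally have "\<sigma> * ((zb - zb') \<bullet> (zb - zb')) \<le> 0" by (simp add: algebra_simps)
    then have "(zb - zb') \<bullet> (zb - zb') \<le> 0" using sigma_pos by (simp add: mult_le_0_iff)
    then have "zb - zb' = 0" by (metis inner_eq_zero_iff inner_ge_zero antisym)
    then show ?thesis by simp
  qed
  then have xb: "xb = xb'" using a(1) b(1) e by simp
  have "denom *\<^sub>R Q wh = denom *\<^sub>R Q wh'"
    unfolding a(3) b(3) using e xb \<open>zb = zb'\<close> by (simp add: lin_simps)
  then have wh: "Q wh = Q wh'" using denom_pos by simp
  have "yb = yb'"
  proof -
    let ?d = "yb - yb'"
    have "0 \<le> (- yb - - yb') \<bullet> ((A (xb + \<sigma> *\<^sub>R resid yb (Q wh) zb) + \<sigma> *\<^sub>R Sy (yb - y))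
       - (A (xb' + \<sigma> *\<^sub>R resid yb' (Q wh') zb') + \<sigma> *\<^sub>R Sy (yb' - y')))"
      using subdiff_monotone[OF a(4) b(4)] .
    also have "(A (xb + \<sigma> *\<^sub>R resid yb (Q wh) zb) + \<sigma> *\<^sub>R Sy (yb - y))
       - (A (xb' + \<sigma> *\<^sub>R resid yb' (Q wh') zb') + \<sigma> *\<^sub>R Sy (yb' - y')) = \<sigma> *\<^sub>R (Sy ?d + A (B ?d))"
      unfolding xb wh \<open>zb = zb'\<close> e by (simp add: lin_simps algebra_simps)
    also have "(- yb - - yb') = - ?d" by simp
    finally have "\<sigma> * (?d \<bullet> (Sy ?d + A (B ?d))) \<le> 0" by (simp only: inner_scaleR_right inner_minus_left)
    then have "?d \<bullet> (Sy ?d + A (B ?d)) \<le> 0" using sigma_pos by (simp add: mult_le_0_iff)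
    then have "?d = 0" using nondegenerate unfolding pos_def_def by (metis not_less)
    then show ?thesis by simp
  qed
  have "denom *\<^sub>R Q wb = denom *\<^sub>R Q wb'"
    unfolding a(5) b(5) using e xb \<open>zb = zb'\<close> \<open>yb = yb'\<close> by (simp add: lin_simps)
  then have "Q wb = Q wb'" using denom_pos by simp
  with xb \<open>zb = zb'\<close> \<open>yb = yb'\<close> show ?thesis by (simp add: u u' apply_Q_def)
qed

lemma resid_line_y: "resid (y + t *\<^sub>R d) v z = resid y v z + t *\<^sub>R B d"
  by (simp add: lin_simps)
lemma resid_line_z: "resid y v (z + t *\<^sub>R d) = resid y v z + t *\<^sub>R d"
  by simp
lemma resid_line_w: "resid y (Q (w + t *\<^sub>R d)) z = resid y (Q w) z + t *\<^sub>R (- Q d)"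
  by (simp add: lin_simps)

lemma z_subproblem:
  assumes fin: "conjugate \<phi> (- z0) \<noteq> \<infinity>"
    and min: "is_arg_min (\<lambda>z. aug_lag Q A c (\<lambda>_. 0) (conjugate \<phi>) \<sigma> y w z x) (\<lambda>_. True) zb"
  shows "- zb \<in> subdiff \<phi> (x + \<sigma> *\<^sub>R resid y (Q w) zb)" "\<bar>conjugate \<phi> (- zb)\<bar> \<noteq> \<infinity>"
proof -
  let ?g = "\<lambda>z. 1/2 * (w \<bullet> Q w) + x \<bullet> resid y (Q w) z + \<sigma>/2 * (norm (resid y (Q w) z))\<^sup>2"
  have "aug_lag Q A c (\<lambda>_. 0) (conjugate \<phi>) \<sigma> y w z x = conjugate \<phi> (- z) + ereal (?g z)" for z
    unfolding aug_lag_def by (cases "conjugate \<phi> (- z)") simp_all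
  with min have min': "is_arg_min (\<lambda>z. conjugate \<phi> (- z) + ereal (?g z)) (\<lambda>_. True) zb" by simp
  have sg: "x + \<sigma> *\<^sub>R resid y (Q w) zb \<in> subdiff (conjugate \<phi>) (- zb)"
  proof (rule arg_min_conjugate_subgradient[OF phi(1) fin min'])
    show "?g (zb + t *\<^sub>R d) = ?g zb + t * ((x + \<sigma> *\<^sub>R resid y (Q w) zb) \<bullet> d) + t\<^sup>2 * (\<sigma>/2 * (norm d)\<^sup>2)" for d t
      unfolding resid_line_z norm_sq_line by (simp add: inner_add_right inner_add_left algebra_simps)
  qed
  show "- zb \<in> subdiff \<phi> (x + \<sigma> *\<^sub>R resid y (Q w) zb)" "\<bar>conjugate \<phi> (- zb)\<bar> \<noteq> \<infinity>"
    by (fact subdiff_conjugate_inverse[OF phi sg]) (use sg in \<open>simp add: subdiff_def\<close>)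
qed

lemma y_subproblem:
  assumes fin: "conjugate (ind_fun K) (- y0) \<noteq> \<infinity>" and q: "\<bar>conjugate \<phi> (- zb)\<bar> \<noteq> \<infinity>"
    and min: "is_arg_min (\<lambda>y'. aug_lag Q A c (conjugate (ind_fun K)) (conjugate \<phi>) \<sigma> y' wh zb xb
                + ereal (\<sigma>/2 * (op_norm Sy (y' - y))\<^sup>2)) (\<lambda>_. True) yb"
  shows "- yb \<in> subdiff (ind_fun K) (A (xb + \<sigma> *\<^sub>R resid yb (Q wh) zb) + \<sigma> *\<^sub>R Sy (yb - y))"
    "\<bar>conjugate (ind_fun K) (- yb)\<bar> \<noteq> \<infinity>"
proof -
  obtain r where r: "conjugate \<phi> (- zb) = ereal r" using q by (cases "conjugate \<phi> (- zb)") auto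
  let ?g = "\<lambda>y'. 1/2 * (wh \<bullet> Q wh) + r + xb \<bullet> resid y' (Q wh) zb + \<sigma>/2 * (norm (resid y' (Q wh) zb))\<^sup>2
     + \<sigma>/2 * ((y' - y) \<bullet> Sy (y' - y))"
  have "aug_lag Q A c (conjugate (ind_fun K)) (conjugate \<phi>) \<sigma> y' wh zb xb + ereal (\<sigma>/2 * (op_norm Sy (y' - y))\<^sup>2)
     = conjugate (ind_fun K) (- y') + ereal (?g y')" for y'
    unfolding aug_lag_def r op_norm_sq[OF Sy_psd]
    by (cases "conjugate (ind_fun K) (- y')") simp_all
  with min have min': "is_arg_min (\<lambda>y'. conjugate (ind_fun K) (- y') + ereal (?g y')) (\<lambda>_. True) yb" by simp
  have sg: "A (xb + \<sigma> *\<^sub>R resid yb (Q wh) zb) + \<sigma> *\<^sub>R Sy (yb - y) \<in> subdiff (conjugate (ind_fun K)) (- yb)"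
  proof (rule arg_min_conjugate_subgradient[OF ind_K(1) fin min'])
    fix d t
    have s: "(yb + t *\<^sub>R d) - y = (yb - y) + t *\<^sub>R d" by simp
    have A: "A v \<bullet> d = v \<bullet> B d" for v using inner_A[of d v] by (simp add: inner_commute)
    have S: "Sy v \<bullet> d = v \<bullet> Sy d" for v using inner_Sy by simp
    show "?g (yb + t *\<^sub>R d) = ?g yb + t * ((A (xb + \<sigma> *\<^sub>R resid yb (Q wh) zb) + \<sigma> *\<^sub>R Sy (yb - y)) \<bullet> d)
       + t\<^sup>2 * (\<sigma>/2 * (norm (B d))\<^sup>2 + \<sigma>/2 * (d \<bullet> Sy d))"
      unfolding resid_line_y norm_sq_line s form_sum_scaled[OF Sy_sa] inner_add_left[of "A _"] A inner_scaleR_left S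
      by (simp add: inner_add_right inner_add_left algebra_simps)
  qed
  show "- yb \<in> subdiff (ind_fun K) (A (xb + \<sigma> *\<^sub>R resid yb (Q wh) zb) + \<sigma> *\<^sub>R Sy (yb - y))"
    "\<bar>conjugate (ind_fun K) (- yb)\<bar> \<noteq> \<infinity>"
    by (fact subdiff_conjugate_inverse[OF ind_K sg]) (use sg in \<open>simp add: subdiff_def\<close>)
qed

lemma Sw_self_adjoint: "self_adjoint (\<lambda>w. Q (lamQ *\<^sub>R w - Q w))"
proof (rule self_adjointI)
  show "linear (\<lambda>w. Q (lamQ *\<^sub>R w - Q w))" by (rule linearI) (simp_all add: lin_simps algebra_simps)
  show "Q (lamQ *\<^sub>R a - Q a) \<bullet> b = a \<bullet> Q (lamQ *\<^sub>R b - Q b)" for a b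
    by (simp add: lin_simps inner_diff_left inner_diff_right inner_Q)
qed

lemma Sw_psd: "pos_semidef (\<lambda>w. Q (lamQ *\<^sub>R w - Q w))"
  unfolding pos_semidef_def
proof
  fix w
  show "0 \<le> w \<bullet> Q (lamQ *\<^sub>R w - Q w)"
    using psd_square_le[OF Q_sa Q_psd Q_le, of w] inner_Q[of w "Q w"]
    by (simp add: lin_simps inner_diff_right)
qed

text \<open>
  The term \<open>\<sigma> Q\<^sup>2\<close> in the Hessian of the augmented Lagrangian is completed by \<open>\<sigma> Q (lamQ I - Q)\<close> from
  the proximal term to \<open>\<sigma> lamQ Q\<close>, so that \<open>Q\<close> factors out of the gradient and the equation becomes
  explicit in \<open>Q wb\<close>.
\<close>

lemma w_subproblem:
  assumes p: "\<bar>p (- y)\<bar> \<noteq> \<infinity>" and q: "\<bar>q (- z)\<bar> \<noteq> \<infinity>"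
    and min: "is_arg_min (\<lambda>w'. aug_lag Q A c p q \<sigma> y w' z xb
                + ereal (\<sigma>/2 * (op_norm (\<lambda>w. Q (lamQ *\<^sub>R w - Q w)) (w' - w))\<^sup>2)) (\<lambda>w'. w' \<in> range Q) wb"
  shows "denom *\<^sub>R Q wb = Q ((\<sigma> * lamQ) *\<^sub>R w + xb + \<sigma> *\<^sub>R resid y (Q w) z)"
proof -
  let ?S = "\<lambda>w. Q (lamQ *\<^sub>R w - Q w)"
  obtain r r' where r: "p (- y) = ereal r" "q (- z) = ereal r'"
    using p q by (cases "p (- y)"; cases "q (- z)") auto
  let ?g = "\<lambda>w'. 1/2 * (w' \<bullet> Q w') + r + r' + xb \<bullet> resid y (Q w') z + \<sigma>/2 * (norm (resid y (Q w') z))\<^sup>2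
     + \<sigma>/2 * ((w' - w) \<bullet> ?S (w' - w))"
  have min': "is_arg_min (\<lambda>w'. ereal (?g w')) (\<lambda>w'. w' \<in> range Q) wb"
    using min unfolding aug_lag_def r op_norm_sq[OF Sw_psd] by simp
  let ?s = "Q (wb - xb - \<sigma> *\<^sub>R resid y (Q wb) z + \<sigma> *\<^sub>R (lamQ *\<^sub>R (wb - w) - Q (wb - w)))"
  have "?s = 0"
  proof (rule arg_min_subspace_gradient[OF linear_subspace_image[OF Q_lin subspace_UNIV] min'])
    fix d t
    have s: "(wb + t *\<^sub>R d) - w = (wb - w) + t *\<^sub>R d" by simp
    have S: "(wb - w) \<bullet> ?S d = ?S (wb - w) \<bullet> d" using self_adjoint_swap[OF Sw_self_adjoint] by simp
    show "?g (wb + t *\<^sub>R d) = ?g wb + t * (?s \<bullet> d)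
      + t\<^sup>2 * (1/2 * (d \<bullet> Q d) + \<sigma>/2 * (norm (Q d))\<^sup>2 + \<sigma>/2 * (d \<bullet> ?S d))"
    proof -
      have sd: "?s \<bullet> d = wb \<bullet> Q d - xb \<bullet> Q d - \<sigma> * (resid y (Q wb) z \<bullet> Q d) + \<sigma> * (?S (wb - w) \<bullet> d)"
        by (simp only: lin_simps inner_add_left inner_diff_left inner_scaleR_left inner_Q)
      then show ?thesis
        unfolding sd resid_line_w norm_sq_line s form_sum_scaled[OF Sw_self_adjoint] form_sum_scaled[OF Q_sa] S
          inner_add_right[of xb "resid y (Q wb) z"]
        by (simp add: algebra_simps)
    qed
  qed simp
  then have "denom *\<^sub>R Q wb = denom *\<^sub>R Q wb - ?s" by simp
  also have "\<dots> = Q ((\<sigma> * lamQ) *\<^sub>R w + xb + \<sigma> *\<^sub>R resid y (Q w) z)"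
    by (simp add: lin_simps algebra_simps)
  finally show ?thesis .
qed

lemma step_A_opt_step:
  assumes fin: "conjugate (ind_fun K) (- y0) \<noteq> \<infinity>" "conjugate \<phi> (- z0) \<noteq> \<infinity>"
    and step: "step_A Q A c \<phi> K \<sigma> (\<lambda>w. Q (lamQ *\<^sub>R w - Q w)) Sy u ub"
  shows "opt_step u ub"
proof -
  obtain y w z x yb wb zb xb wh where u: "u = (y, w, z, x)" "ub = (yb, wb, zb, xb)"
    and s: "is_arg_min (\<lambda>z'. aug_lag Q A c (\<lambda>_. 0) (conjugate \<phi>) \<sigma> y w z' x) (\<lambda>_. True) zb"
       "xb = x + \<sigma> *\<^sub>R (- Q w + adjoint A y + zb - c)"
       "is_arg_min (\<lambda>w'. aug_lag Q A c (\<lambda>_. 0) (conjugate \<phi>) \<sigma> y w' zb xb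
            + ereal (\<sigma>/2 * (op_norm (\<lambda>w. Q (lamQ *\<^sub>R w - Q w)) (w' - w))\<^sup>2)) (\<lambda>w'. w' \<in> range Q) wh"
       "is_arg_min (\<lambda>y'. aug_lag Q A c (conjugate (ind_fun K)) (conjugate \<phi>) \<sigma> y' wh zb xb
                + ereal (\<sigma>/2 * (op_norm Sy (y' - y))\<^sup>2)) (\<lambda>_. True) yb"
       "is_arg_min (\<lambda>w'. aug_lag Q A c (conjugate (ind_fun K)) (conjugate \<phi>) \<sigma> yb w' zb xb
            + ereal (\<sigma>/2 * (op_norm (\<lambda>w. Q (lamQ *\<^sub>R w - Q w)) (w' - w))\<^sup>2)) (\<lambda>w'. w' \<in> range Q) wb"
    using step unfolding step_A_def by blast
  note z = z_subproblem[OF fin(2) s(1)]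
  note y = y_subproblem[OF fin(1) z(2) s(4)]
  have "denom *\<^sub>R Q wh = Q ((\<sigma> * lamQ) *\<^sub>R w + xb + \<sigma> *\<^sub>R resid y (Q w) zb)"
    by (rule w_subproblem[OF _ z(2) s(3)]) simp
  moreover have "denom *\<^sub>R Q wb = Q ((\<sigma> * lamQ) *\<^sub>R w + xb + \<sigma> *\<^sub>R resid yb (Q w) zb)"
    by (rule w_subproblem[OF y(2) z(2) s(5)])
  ultimately show ?thesis unfolding opt_step_def using u s(2) z(1) y(1) by blast
qed

lemma step_B_opt_step:
  assumes fin: "conjugate (ind_fun K) (- y0) \<noteq> \<infinity>" "conjugate \<phi> (- z0) \<noteq> \<infinity>"
    and step: "step_B Q A c \<phi> K \<sigma> lamQ Sy u ub"
  shows "opt_step u ub"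
proof -
  obtain y w z x yb wb zb xb wh where u: "u = (y, w, z, x)" "ub = (yb, wb, zb, xb)"
    and s: "is_arg_min (\<lambda>z'. aug_lag Q A c (\<lambda>_. 0) (conjugate \<phi>) \<sigma> y w z' x) (\<lambda>_. True) zb"
       "xb = x + \<sigma> *\<^sub>R (- Q w + adjoint A y + zb - c)"
       "wh = (1 / (1 + \<sigma> * lamQ)) *\<^sub>R ((\<sigma> * lamQ) *\<^sub>R w + xb + \<sigma> *\<^sub>R (- Q w + adjoint A y + zb - c))"
       "is_arg_min (\<lambda>y'. aug_lag Q A c (conjugate (ind_fun K)) (conjugate \<phi>) \<sigma> y' wh zb xb
                + ereal (\<sigma>/2 * (op_norm Sy (y' - y))\<^sup>2)) (\<lambda>_. True) yb"
       "wb = (1 / (1 + \<sigma> * lamQ)) *\<^sub>R ((\<sigma> * lamQ) *\<^sub>R w + xb + \<sigma> *\<^sub>R (- Q w + adjoint A yb + zb - c))"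
    using step unfolding step_B_def by blast
  note z = z_subproblem[OF fin(2) s(1)]
  note y = y_subproblem[OF fin(1) z(2) s(4)]
  have "denom *\<^sub>R Q v' = Q v" if "v' = (1 / denom) *\<^sub>R v" for v v'
    unfolding that linear_cmul[OF Q_lin] using denom_pos by simp
  from this[OF s(3)] this[OF s(5)] show ?thesis
    unfolding opt_step_def using u s(2) z(1) y(1) by blast
qed

section \<open>KKT points solve both problems\<close>

lemma quadratic_gradient_ineq: "1/2 * (v \<bullet> Q v) + Q v \<bullet> (v' - v) \<le> 1/2 * (v' \<bullet> Q v')"
proof -
  have "v' = v + (v' - v)" by simp
  then have "v' \<bullet> Q v' = v \<bullet> Q v + 2 * (v \<bullet> Q (v' - v)) + (v' - v) \<bullet> Q (v' - v)"
    using form_sum[OF Q_sa] by metis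
  moreover have "0 \<le> (v' - v) \<bullet> Q (v' - v)" using Q_psd by (simp add: pos_semidef_def)
  ultimately show ?thesis using inner_Q[of v "v' - v"] by simp
qed

text \<open>
  Add the gradient inequality of the quadratic, the subgradient inequality of \<open>\<phi>\<close> at \<open>x\<close> and the normal cone
  inequality of \<open>K\<close> at \<open>A x\<close>; the linear terms cancel by the last KKT equation.
\<close>

lemma kkt_solves_primal:
  assumes "kkt_op (y, w, z, x) 0"
  shows "solves_primal Q A c \<phi> K x"
proof -
  have k: "- y \<in> subdiff (ind_fun K) (A x)" "Q w = Q x" "- z \<in> subdiff \<phi> x" "Q w - B y - z + c = 0"
    using assms by (auto simp: kkt_op_def zero_prod_def)
  have Ax: "A x \<in> K" using k(1) by (auto simp: subdiff_def ind_fun_def split: if_splits)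
  obtain r where r: "\<phi> x = ereal r" "\<And>x'. ereal (r + (- z) \<bullet> (x' - x)) \<le> \<phi> x'"
    using k(3) unfolding subdiff_iff by blast
  have "ereal (1/2 * (x \<bullet> Q x) + c \<bullet> x) + \<phi> x \<le> ereal (1/2 * (x' \<bullet> Q x') + c \<bullet> x') + \<phi> x'"
    if x': "A x' \<in> K" for x'
  proof (cases "\<phi> x'")
    case (real r')
    have "(- y) \<bullet> (A x' - A x) \<le> 0"
      using k(1) x' Ax unfolding subdiff_def ind_fun_def by (auto dest: spec[of _ "A x'"])
    then have "0 \<le> B y \<bullet> (x' - x)" using inner_A[of y "x' - x"] by (simp add: lin_simps)
    moreover have "B y = Q x + c - z" using k(2,4) by (simp add: algebra_simps)
    ultimately have "0 \<le> Q x \<bullet> (x' - x) + c \<bullet> (x' - x) - z \<bullet> (x' - x)" by (simp add: inner_add_left inner_diff_left)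
    moreover have "r - z \<bullet> (x' - x) \<le> r'" using r(2)[of x'] real by simp
    ultimately have "1/2 * (x \<bullet> Q x) + c \<bullet> x + r \<le> 1/2 * (x' \<bullet> Q x') + c \<bullet> x' + r'"
      using quadratic_gradient_ineq[of x x'] unfolding inner_diff_right[of c] by linarith
    then show ?thesis by (simp add: r real)
  next
    case MInf
    with phi(1) show ?thesis by (simp add: proper_fun_def)
  qed simp
  with Ax show ?thesis unfolding solves_primal_def is_arg_min_def by (auto simp: not_less)
qed

text \<open>
  Add the subgradient inequalities of both conjugates and the gradient inequality of the quadratic; on the feasible set
  the linear terms cancel because \<open>Q w = Q x\<close>.
\<close>

lemma kkt_solves_dual:
  assumes "kkt_op (y, w, z, x) 0" "w \<in> range Q"
  shows "solves_dual Q A c \<phi> K (y, w, z)"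
proof -
  have k: "- y \<in> subdiff (ind_fun K) (A x)" "Q w = Q x" "- z \<in> subdiff \<phi> x" "Q w - B y - z + c = 0"
    using assms by (auto simp: kkt_op_def zero_prod_def)
  obtain p where p: "conjugate (ind_fun K) (- y) = ereal p"
      "\<And>v. ereal (p + A x \<bullet> (v - (- y))) \<le> conjugate (ind_fun K) v"
    using subdiff_conjugate[OF ind_K(1) k(1)] unfolding subdiff_iff by blast
  obtain q where q: "conjugate \<phi> (- z) = ereal q"
      "\<And>v. ereal (q + x \<bullet> (v - (- z))) \<le> conjugate \<phi> v"
    using subdiff_conjugate[OF phi(1) k(3)] unfolding subdiff_iff by blast
  have feas: "- Q w + B y + z = c" using k(4) by (simp add: algebra_simps)
  have "ereal (1/2 * (w \<bullet> Q w)) + conjugate (ind_fun K) (- y) + conjugate \<phi> (- z)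
     \<le> ereal (1/2 * (w' \<bullet> Q w')) + conjugate (ind_fun K) (- y') + conjugate \<phi> (- z')"
    if feas': "- Q w' + B y' + z' = c" for y' w' z'
  proof (cases "conjugate (ind_fun K) (- y')"; cases "conjugate \<phi> (- z')")
    fix p' q' assume pq: "conjugate (ind_fun K) (- y') = ereal p'" "conjugate \<phi> (- z') = ereal q'"
    have "p + A x \<bullet> (y - y') \<le> p'" using p(2)[of "- y'"] pq(1) by simp
    moreover have "q + x \<bullet> (z - z') \<le> q'" using q(2)[of "- z'"] pq(2) by simp
    moreover have "A x \<bullet> (y - y') + x \<bullet> (z - z') + Q w \<bullet> (w' - w) = 0"
    proof -
      have "B (y - y') + (z - z') = Q (w - w')"
        using feas feas' by (simp add: lin_simps algebra_simps)
      then have "x \<bullet> B (y - y') + x \<bullet> (z - z') = x \<bullet> Q (w - w')" by (metis inner_add_right)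
      moreover have "x \<bullet> Q (w - w') = - (Q w \<bullet> (w' - w))"
        unfolding inner_Q k(2) by (simp add: inner_diff_right)
      moreover have "A x \<bullet> (y - y') = x \<bullet> B (y - y')" using inner_A[of "y - y'" x] by (simp add: inner_commute)
      ultimately show ?thesis by linarith
    qed
    ultimately have "1/2 * (w \<bullet> Q w) + p + q \<le> 1/2 * (w' \<bullet> Q w') + p' + q'"
      using quadratic_gradient_ineq[of w w'] by linarith
    then show ?thesis by (simp add: p q pq)
  qed (use conjugate_not_MInf[OF ind_K(1)] conjugate_not_MInf[OF phi(1)] in auto)
  with feas assms(2) show ?thesis unfolding solves_dual_def is_arg_min_def by (auto simp: not_less)
qed

lemma KKT_point_kkt_op:
  assumes "KKT_point Q A c \<phi> K y w z x"
  shows "kkt_op (y, w, z, x) 0" "w \<in> range Q"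
    "conjugate (ind_fun K) (- y) \<noteq> \<infinity>" "conjugate \<phi> (- z) \<noteq> \<infinity>"
  using assms subdiff_conjugate_inverse[OF ind_K, of "A x" "- y"] subdiff_conjugate_inverse[OF phi, of x "- z"]
  by (auto simp: KKT_point_def kkt_op_def zero_prod_def subdiff_def algebra_simps)

lemma halpern_apply_Q:
  fixes u0 u ub :: "('m, 'n) state"
  shows "apply_Q Q (halpern_update k u0 u ub) = halpern_update k (apply_Q Q u0) (apply_Q Q u) (apply_Q Q ub)"
  unfolding halpern_update_def
  by (simp add: linear_add[OF apply_Q_linear] linear_diff[OF apply_Q_linear] linear_cmul[OF apply_Q_linear])

end

section \<open>Box constraints\<close>

lemma box_set_closed:
  fixes l u :: "'m::finite \<Rightarrow> ereal"
  shows "closed (box_set l u)"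
proof -
  have "closed {y::real^'m. l i \<le> ereal (y $ i) \<and> ereal (y $ i) \<le> u i}" for i
    by (intro closed_Collect_conj closed_Collect_le continuous_intros)
  then show ?thesis unfolding box_set_def by (intro closed_Collect_all)
qed

lemma box_set_convex:
  fixes l u :: "'m::finite \<Rightarrow> ereal"
  shows "convex (box_set l u)"
proof (rule convexI)
  fix x y :: "real^'m" and s t :: real
  assume xy: "x \<in> box_set l u" "y \<in> box_set l u" and st: "0 \<le> s" "0 \<le> t" "s + t = 1"
  have "l i \<le> ereal (s * x $ i + t * y $ i) \<and> ereal (s * x $ i + t * y $ i) \<le> u i" for i
  proof -
    have b: "min (x $ i) (y $ i) \<le> s * x $ i + t * y $ i" "s * x $ i + t * y $ i \<le> max (x $ i) (y $ i)"
      using convex_bound_le[of "x $ i" "max (x $ i) (y $ i)" "y $ i" s t]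
        convex_bound_le[of "- x $ i" "- min (x $ i) (y $ i)" "- y $ i" s t] st by auto
    have "l i \<le> ereal (min (x $ i) (y $ i))" "ereal (max (x $ i) (y $ i)) \<le> u i"
      using xy by (auto simp: box_set_def min_def max_def)
    with b show ?thesis by (meson ereal_less_eq(3) order_trans)
  qed
  then show "s *\<^sub>R x + t *\<^sub>R y \<in> box_set l u" by (simp add: box_set_def)
qed

lemma epi_ind_fun: "epi (ind_fun K) = K \<times> {0..}"
  by (auto simp: epi_def ind_fun_def split: if_splits)


lemma box_indicator_proper_closed_convex:
  fixes l u :: "'m::finite \<Rightarrow> ereal"
  assumes "box_set l u \<noteq> {}"
  shows "proper_fun (ind_fun (box_set l u))" "closed_fun (ind_fun (box_set l u))"
    "convex_fun (ind_fun (box_set l u))"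
proof -
  show "proper_fun (ind_fun (box_set l u))"
    using assms by (auto simp: proper_fun_def ind_fun_def)
  show "closed_fun (ind_fun (box_set l u))"
    unfolding closed_fun_def epi_ind_fun by (intro closed_Times box_set_closed closed_atLeast)
  show "convex_fun (ind_fun (box_set l u))"
    unfolding convex_fun_def epi_ind_fun by (intro convex_Times box_set_convex) simp
qed

text \<open>
  The conjugate of the function that is identically \<open>\<infinity>\<close> is identically \<open>-\<infinity>\<close> and has no subgradients.
\<close>

lemma subdiff_conjugate_indicator_nonempty:
  assumes "s \<in> subdiff (conjugate (ind_fun K)) v" shows "K \<noteq> {}"
proof
  assume "K = {}"
  then have "conjugate (ind_fun K) v = - \<infinity>" by (simp add: conjugate_def ind_fun_def)
  with assms show False by (simp add: subdiff_def)
qed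

section \<open>Equivalence and convergence of the two algorithms\<close>

theorem theorem2p1:
  fixes Q :: "real^'n \<Rightarrow> real^'n" and A :: "real^'n \<Rightarrow> real^'m" and c :: "real^'n"
    and \<phi> :: "real^'n \<Rightarrow> ereal" and l u :: "'m \<Rightarrow> ereal" and K :: "(real^'m) set"
    and \<sigma> lamQ :: real and Sw :: "real^'n \<Rightarrow> real^'n" and Sy :: "real^'m \<Rightarrow> real^'m"
    and y0 :: "real^'m" and w0 z0 x0 :: "real^'n"
    and uA ubA uB ubB :: "nat \<Rightarrow> ('m, 'n) state"
  assumes "self_adjoint Q" and "pos_semidef Q"
    and "linear A"
    and "proper_fun \<phi>" and "closed_fun \<phi>" and "convex_fun \<phi>"
    and "K = box_set l u"
    and "\<exists>y w z x. KKT_point Q A c \<phi> K y w z x"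
    and "\<sigma> > 0"
    and "lamQ > 0" and "lamQ \<ge> largest_eigenvalue Q"
    and "Sw = (\<lambda>w. Q (lamQ *\<^sub>R w - Q w))"
    and "self_adjoint Sy" and "pos_semidef Sy"
    and "pos_def (\<lambda>y. Sy y + A (adjoint A y))"
    and "w0 \<in> range Q"
    and "generated_A Q A c \<phi> K \<sigma> Sw Sy (y0, w0, z0, x0) uA ubA"
    and "generated_B Q A c \<phi> K \<sigma> lamQ Sy (y0, w0, z0, x0) uB ubB"
  shows "(\<forall>k\<ge>1. apply_Q Q (ubB k) = apply_Q Q (ubA k)) \<and>
    (\<exists>y w z x.
       (\<lambda>k. apply_Q Q (ubB k)) \<longlonglongrightarrow> (y, Q w, z, x) \<and>
       (\<lambda>k. apply_Q Q (ubA k)) \<longlonglongrightarrow> (y, Q w, z, x) \<and>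
       solves_dual Q A c \<phi> K (y, w, z) \<and>
       solves_primal Q A c \<phi> K x)"
proof -
  obtain ys ws zs xs where kkt: "KKT_point Q A c \<phi> K ys ws zs xs" using assms(8) by blast
  then have "K \<noteq> {}" unfolding KKT_point_def using subdiff_conjugate_indicator_nonempty by blast
  then have ind: "proper_fun (ind_fun K)" "closed_fun (ind_fun K)" "convex_fun (ind_fun K)"
    unfolding \<open>K = box_set l u\<close> by (simp_all add: box_indicator_proper_closed_convex)
  interpret composite_qp Q A c \<phi> K \<sigma> lamQ Sy
  proof (rule composite_qp.intro)
    show "w \<bullet> Q w \<le> lamQ * (w \<bullet> w)" for w
      using rayleigh_le_largest_eigenvalue[OF assms(1), of w] mult_right_mono[OF assms(11), of "w \<bullet> w"]
      by simp
  qed (fact assms ind)+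
  note fin = KKT_point_kkt_op(3,4)[OF kkt]
  have stepA: "opt_step (uA k) (ubA (Suc k))" for k
    using assms(17) step_A_opt_step[OF fin] unfolding generated_A_def assms(12) by blast
  have stepB: "opt_step (uB k) (ubB (Suc k))" for k
    using assms(18) step_B_opt_step[OF fin] unfolding generated_B_def by blast
  have initA: "uA 0 = (y0, w0, z0, x0)" and initB: "uB 0 = (y0, w0, z0, x0)"
    using assms(17,18) by (auto simp: generated_A_def generated_B_def)
  have updA: "uA (Suc k) = halpern_update k (uA 0) (uA k) (ubA (Suc k))" for k
    using assms(17) by (simp add: generated_A_def)
  have updB: "uB (Suc k) = halpern_update k (uB 0) (uB k) (ubB (Suc k))" for k
    using assms(18) by (simp add: generated_B_def)
  have same: "apply_Q Q (uB k) = apply_Q Q (uA k)" for k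
  proof (induction k)
    case (Suc k)
    have "apply_Q Q (ubB (Suc k)) = apply_Q Q (ubA (Suc k))" by (rule opt_step_unique[OF stepB stepA Suc])
    then show ?case unfolding updA updB halpern_apply_Q Suc initA initB by simp
  qed (simp add: initA initB)
  have sameb: "apply_Q Q (ubB k) = apply_Q Q (ubA k)" if "k \<ge> 1" for k
    using opt_step_unique[OF stepB stepA same, of "k - 1"] that by simp
  have "kkt_zeros \<noteq> {}" using KKT_point_kkt_op(1,2)[OF kkt] by (auto simp: kkt_zeros_def)
  then obtain p where p: "p \<in> kkt_zeros" and limA: "(\<lambda>k. apply_Q Q (ubA k)) \<longlonglongrightarrow> apply_Q Q p"
    using halpern_resolvents_converge[of ubA uA] opt_step_kkt_op[OF stepA] updA by blast
  obtain y w z x where p': "p = (y, w, z, x)" by (metis prod_cases4)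
  have "eventually (\<lambda>k. apply_Q Q (ubA k) = apply_Q Q (ubB k)) sequentially"
    using eventually_ge_at_top[of 1] by (rule eventually_mono) (simp add: sameb)
  then have limB: "(\<lambda>k. apply_Q Q (ubB k)) \<longlonglongrightarrow> apply_Q Q p"
    using limA by (rule Lim_transform_eventually[rotated])
  have "kkt_op (y, w, z, x) 0" "w \<in> range Q" using p by (auto simp: kkt_zeros_def p')
  then have "solves_dual Q A c \<phi> K (y, w, z)" "solves_primal Q A c \<phi> K x"
    using kkt_solves_dual kkt_solves_primal by blast+
  moreover have "apply_Q Q p = (y, Q w, z, x)" by (simp add: p' apply_Q_def)
  ultimately show ?thesis using sameb limA limB by metis
qed

end
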